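(* Let $X$ be a locally compact, strongly locally homogeneous separable metric space, and let $G\subset X$ be a region with $\dim G=n$ for some integer $n\ge 2$. Then $G$ is not separated by any arc $J\subset G$; that is, for every arc $J\subset G$ the set $G\setminus J$ is connected.
   Context: All spaces are separable metric. $\dim$ denotes covering dimension. A space $X$ is strongly locally homogeneous if every point $x\in X$ has a local basis of open sets $U$ such that for all $y,z\in U$ there is a homeomorphism $h$ of $X$ onto itself with $h(y)=z$ and $h$ equal to the identity on $X\setminus U$. A region in $X$ is a connected open subset of $X$. An arc is a space homeomorphic to $[0,1]$. A subset $J\subset G$ separates $G$ if $G\setminus J$ is the union of two disjoint nonempty open subsets of $G\setminus J$. *)

theory Defs
  imports "HOL-Analysis.Analysis"
begin

definition strongly_locally_homogeneous :: "'a topology \<Rightarrow> bool"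
  where "strongly_locally_homogeneous X \<longleftrightarrow>
    (\<forall>x W. openin X W \<and> x \<in> W \<longrightarrow>
      (\<exists>U. openin X U \<and> x \<in> U \<and> U \<subseteq> W \<and>
        (\<forall>y\<in>U. \<forall>z\<in>U. \<exists>h. homeomorphic_map X X h \<and> h y = z \<and>
          (\<forall>p \<in> topspace X - U. h p = p))))"

text \<open>Cech-Lebesgue covering dimension, by finite open covers and finite open refinements; for
  metrizable spaces this agrees with the definition by arbitrary open covers. The order bound says
  that every point lies in at most \<open>n + 1\<close> distinct members of the refinement. The values are
  integers because the empty space, and only it, has dimension \<open>-1\<close>; the condition
  \<open>-1 \<le> n\<close> keeps that value unique.\<close>

definition covering_dim_le :: "'a topology \<Rightarrow> int \<Rightarrow> bool"
  where "covering_dim_le X n \<longleftrightarrow>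
    -1 \<le> n \<and>
    (\<forall>\<U>. finite \<U> \<and> (\<forall>U\<in>\<U>. openin X U) \<and> \<Union>\<U> = topspace X \<longrightarrow>
      (\<exists>\<V>. finite \<V> \<and> (\<forall>V\<in>\<V>. openin X V) \<and> \<Union>\<V> = topspace X \<and>
        (\<forall>V\<in>\<V>. \<exists>U\<in>\<U>. V \<subseteq> U) \<and>
        (\<forall>x\<in>topspace X. int (card {V \<in> \<V>. x \<in> V}) \<le> n + 1)))"

definition has_covering_dim :: "'a topology \<Rightarrow> int \<Rightarrow> bool"
  where "has_covering_dim X n \<longleftrightarrow> covering_dim_le X n \<and> \<not> covering_dim_le X (n - 1)"

definition region_in :: "'a topology \<Rightarrow> 'a set \<Rightarrow> bool"
  where "region_in X G \<longleftrightarrow> openin X G \<and> connectedin X G"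

definition arc_in :: "'a topology \<Rightarrow> 'a set \<Rightarrow> bool"
  where "arc_in X J \<longleftrightarrow>
    J \<subseteq> topspace X \<and> subtopology X J homeomorphic_space top_of_set {0..1::real}"

definition separates_in :: "'a topology \<Rightarrow> 'a set \<Rightarrow> 'a set \<Rightarrow> bool"
  where "separates_in X J G \<longleftrightarrow>
    (\<exists>A B. openin (subtopology X (G - J)) A \<and> openin (subtopology X (G - J)) B \<and>
      A \<noteq> {} \<and> B \<noteq> {} \<and> A \<inter> B = {} \<and> A \<union> B = G - J)"

end

theory Submission
  imports Defs
begin

text \<open>Dimension at least two yields a compact set \<open>M\<close>, a closed \<open>F \<subseteq> M\<close> and a map from \<open>F\<close> to the
  punctured plane without extension over \<open>M\<close>; a minimal such \<open>M\<close> is a membrane. A membrane is not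
  separated by a closed set \<open>L\<close> on which nonvanishing functions have logarithms and which meets \<open>F\<close> in
  at most one point. Suppose that \<open>A\<close> and \<open>B\<close> separate the complement of an arc \<open>J\<close>, and let \<open>p\<close> be
  the first point of \<open>J\<close> in both closures, so that the part \<open>J'\<close> of \<open>J\<close> from \<open>p\<close> on already separates
  \<open>A\<close> from \<open>B\<close>. By homogeneity some membrane has \<open>p\<close> off its boundary \<open>F\<close>. Adding a terminal
  piece of \<open>J'\<close> to \<open>F\<close> gives a membrane whose boundary meets the remaining initial piece of \<open>J'\<close> in
  at most one point, and which can be moved to contain \<open>p\<close> again. It contains a point \<open>x\<close> off its
  boundary and off \<open>J'\<close>, in the closure of \<open>A\<close>, say. A homeomorphism supported near \<open>p\<close> then moves
  \<open>p\<close> into \<open>B\<close> and keeps \<open>x\<close>, and the resulting membrane is separated by \<open>J'\<close>, a contradiction.\<close>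

section \<open>Nonvanishing functions and membranes\<close>

definition nonvanishing_on :: "'a topology \<Rightarrow> 'a set \<Rightarrow> ('a \<Rightarrow> complex) \<Rightarrow> bool"
  where "nonvanishing_on X S g \<longleftrightarrow>
    continuous_map (subtopology X S) euclidean g \<and> (\<forall>x\<in>S. g x \<noteq> 0)"

definition nonvanishing_extension ::
    "'a topology \<Rightarrow> 'a set \<Rightarrow> ('a \<Rightarrow> complex) \<Rightarrow> 'a set \<Rightarrow> bool"
  where "nonvanishing_extension X F f S \<longleftrightarrow> (\<exists>g. nonvanishing_on X S g \<and> (\<forall>x\<in>F. g x = f x))"

text \<open>A membrane imitates a disc with boundary \<open>F\<close>. For the unit disc with the
  identity on its bounding circle, the boundary values do not extend, but after removal of one
  interior point a radial projection extends them.\<close>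

definition membrane :: "'a topology \<Rightarrow> 'a set \<Rightarrow> ('a \<Rightarrow> complex) \<Rightarrow> 'a set \<Rightarrow> bool"
  where "membrane X F f M \<longleftrightarrow>
    compactin X M \<and> closedin X M \<and> closedin X F \<and> F \<subseteq> M \<and> nonvanishing_on X F f \<and>
    \<not> nonvanishing_extension X F f M \<and>
    (\<forall>N. closedin X N \<and> F \<subseteq> N \<and> N \<subset> M \<longrightarrow> nonvanishing_extension X F f N)"

lemma nonvanishing_on_subset:
  "nonvanishing_on X S g \<Longrightarrow> T \<subseteq> S \<Longrightarrow> nonvanishing_on X T g"
  unfolding nonvanishing_on_def by (meson continuous_map_from_subtopology_mono subsetD)

lemma nonvanishing_on_cong:
  assumes "nonvanishing_on X S g" "\<And>x. x \<in> S \<Longrightarrow> g x = h x"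
  shows "nonvanishing_on X S h"
  using assms continuous_map_eq[of "subtopology X S" euclidean g h]
  unfolding nonvanishing_on_def by fastforce

lemma continuous_map_compose_continuous:
  assumes "continuous_map X euclidean g" "continuous_on UNIV h"
  shows "continuous_map X euclidean (\<lambda>x. h (g x))"
  using continuous_map_compose[of X euclidean g euclidean h] assms
  by (simp add: o_def)

lemma nonvanishing_on_exp:
  assumes "continuous_map (subtopology X S) euclidean \<phi>"
  shows "nonvanishing_on X S (\<lambda>x. exp (\<phi> x))"
  unfolding nonvanishing_on_def
  by (simp add: assms continuous_map_compose_continuous continuous_on_exp)

lemma nonvanishing_on_mult:
  assumes "nonvanishing_on X S g" "nonvanishing_on X S h"
  shows "nonvanishing_on X S (\<lambda>x. g x * h x)"
  using assms unfolding nonvanishing_on_def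
  by (simp add: continuous_map_atin tendsto_mult)

lemma nonvanishing_on_divide:
  assumes "nonvanishing_on X S g" "nonvanishing_on X S h"
  shows "nonvanishing_on X S (\<lambda>x. g x / h x)"
  using assms unfolding nonvanishing_on_def
  by (simp add: continuous_map_atin tendsto_divide)

lemma closedin_pasting:
  assumes S: "closedin X S" and T: "closedin X T"
    and g: "continuous_map (subtopology X S) Y g" and h: "continuous_map (subtopology X T) Y h"
    and eq: "\<And>x. x \<in> S \<Longrightarrow> x \<in> T \<Longrightarrow> g x = h x"
  obtains k where "continuous_map (subtopology X (S \<union> T)) Y k"
    "\<And>x. x \<in> S \<Longrightarrow> k x = g x" "\<And>x. x \<in> T \<Longrightarrow> k x = h x"
proof
  let ?k = "\<lambda>x. if x \<in> S then g x else h x"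
  let ?Z = "subtopology X (S \<union> T)"
  show "continuous_map ?Z Y ?k"
  proof (rule pasting_lemma_closed[where I = "UNIV::bool set"
        and T = "\<lambda>b. if b then S else T" and f = "\<lambda>b. if b then g else h"])
    show "closedin ?Z (if b then S else T)" for b
      using S T by (auto intro: closedin_subset_topspace)
    show "continuous_map (subtopology ?Z (if b then S else T)) Y (if b then g else h)" for b
      using g h by (cases b) (auto simp: subtopology_subtopology Int_absorb1)
    show "\<exists>j. j \<in> UNIV \<and> x \<in> (if j then S else T) \<and> ?k x = (if j then g else h) x"
      if "x \<in> topspace ?Z" for x
      using that by (cases "x \<in> S") (auto intro: exI[of _ True] exI[of _ False])
    fix i j x
    assume "x \<in> topspace ?Z \<inter> (if i then S else T) \<inter> (if j then S else T)"
    then show "(if i then g else h) x = (if j then g else h) x"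
      using eq by (cases i; cases j) (auto simp: eq)
  qed simp
  show "\<And>x. x \<in> T \<Longrightarrow> ?k x = h x"
    using eq by auto
qed auto

lemma nonvanishing_pasting:
  assumes "closedin X S" "closedin X T" "nonvanishing_on X S g" "nonvanishing_on X T h"
    and "\<And>x. x \<in> S \<Longrightarrow> x \<in> T \<Longrightarrow> g x = h x"
  obtains k where "nonvanishing_on X (S \<union> T) k"
    "\<And>x. x \<in> S \<Longrightarrow> k x = g x" "\<And>x. x \<in> T \<Longrightarrow> k x = h x"
proof -
  obtain k where "continuous_map (subtopology X (S \<union> T)) euclidean k"
    "\<And>x. x \<in> S \<Longrightarrow> k x = g x" "\<And>x. x \<in> T \<Longrightarrow> k x = h x"
    using closedin_pasting[of X S T euclidean g h] assms unfolding nonvanishing_on_def by metis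
  with assms that show ?thesis
    unfolding nonvanishing_on_def by (metis Un_iff)
qed

lemma Tietze_extension_complex:
  fixes f :: "'a \<Rightarrow> complex"
  assumes "normal_space X" "closedin X S" "continuous_map (subtopology X S) euclidean f"
  obtains g where "continuous_map X euclidean g" "\<And>x. x \<in> S \<Longrightarrow> g x = f x"
proof -
  have *: "\<exists>u. continuous_map X euclideanreal u \<and> (\<forall>x\<in>S. u x = c (f x))"
    if "continuous_on UNIV c" for c :: "complex \<Rightarrow> real"
    using Tietze_extension_realinterval[OF assms(1,2) is_interval_univ UNIV_not_empty
        continuous_map_compose_continuous[OF assms(3) that]]
    by (metis subset_UNIV)
  obtain u v where u: "continuous_map X euclideanreal u" "\<forall>x\<in>S. u x = Re (f x)"
    and v: "continuous_map X euclideanreal v" "\<forall>x\<in>S. v x = Im (f x)"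
    using *[OF linear_continuous_on[OF bounded_linear_Re]] *[OF linear_continuous_on[OF bounded_linear_Im]]
    by blast
  show ?thesis
  proof
    show "continuous_map X euclidean (\<lambda>x. Complex (u x) (v x))"
      using u v by (simp add: continuous_map_atin tendsto_Complex)
  qed (use u v in \<open>auto simp: complex_eq_iff\<close>)
qed

text \<open>Nonextendability passes to the intersection of a chain by compactness, so Zorn's lemma
  applies. If \<open>f\<close> extended over the intersection, a continuous extension to all of
  \<open>X\<close> would be nonzero on an open \<open>W\<close> around it, one member of the chain
  would lie inside \<open>W\<close>, and \<open>f\<close> would extend over that member.\<close>

lemma membrane_exists:
  assumes X: "normal_space X" and M: "compactin X M" "closedin X M"
    and F: "closedin X F" "F \<subseteq> M" and f: "nonvanishing_on X F f"
    and no_ext: "\<not> nonvanishing_extension X F f M"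
  obtains N where "N \<subseteq> M" "membrane X F f N"
proof -
  \<comment> \<open>\<open>T\<close> is the part of \<open>M\<close> that is removed. Maximal
    \<open>T\<close> correspond to minimal \<open>M - T\<close>, the direction in which
    \<open>subset_Zorn_nonempty\<close> works.\<close>
  define \<A> where "\<A> = {T. T \<subseteq> M \<and> openin X (topspace X - (M - T)) \<and> F \<subseteq> M - T \<and>
    \<not> nonvanishing_extension X F f (M - T)}"
  have Msub: "M \<subseteq> topspace X"
    using M by (simp add: closedin_subset)
  have "\<exists>T\<in>\<A>. \<forall>S\<in>\<A>. T \<subseteq> S \<longrightarrow> S = T"
  proof (rule subset_Zorn_nonempty)
    have "{} \<in> \<A>"
      using M F no_ext by (auto simp: \<A>_def)
    then show "\<A> \<noteq> {}" by blast
    fix \<C> assume ne: "\<C> \<noteq> {}" and ch: "subset.chain \<A> \<C>"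
    then have sub: "\<C> \<subseteq> \<A>"
      by (simp add: subset.chain_def)
    let ?N = "M - \<Union>\<C>"
    have eq: "topspace X - ?N = \<Union>((\<lambda>T. topspace X - (M - T)) ` \<C>)"
      using ne Msub sub by (auto simp: \<A>_def)
    have op: "openin X (topspace X - ?N)"
      unfolding eq by (rule openin_Union) (use sub in \<open>auto simp: \<A>_def\<close>)
    then have cl: "closedin X ?N"
      using Msub by (auto simp: closedin_def)
    have "\<not> nonvanishing_extension X F f ?N"
    proof
      assume "nonvanishing_extension X F f ?N"
      then obtain g where g: "nonvanishing_on X ?N g" and gf: "\<forall>x\<in>F. g x = f x"
        by (auto simp: nonvanishing_extension_def)
      obtain G where G: "continuous_map X euclidean G" "\<And>x. x \<in> ?N \<Longrightarrow> G x = g x"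
        using Tietze_extension_complex[OF X cl] g unfolding nonvanishing_on_def by metis
      define W where "W = {x \<in> topspace X. G x \<in> -{0}}"
      have W: "openin X W"
        using G(1) unfolding W_def
        by (rule openin_continuous_map_preimage) (simp add: open_Compl flip: open_openin)
      \<comment> \<open>\<open>W\<close> covers the intersection, and the complements of the chain
        members cover the rest of \<open>M\<close>. As these complements form a chain, a single one
        can replace those in a finite subcover.\<close>
      let ?\<U> = "insert W ((\<lambda>T. topspace X - (M - T)) ` \<C>)"
      have "M \<subseteq> \<Union>?\<U>"
        using G(2) g Msub by (auto simp: W_def nonvanishing_on_def)
      moreover have "\<forall>U\<in>?\<U>. openin X U"
        using W sub by (auto simp: \<A>_def)
      ultimately obtain \<F> where \<F>: "finite \<F>" "\<F> \<subseteq> ?\<U>" "M \<subseteq> \<Union>\<F>"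
        using M(1) unfolding compactin_def by metis
      obtain \<D> where \<D>: "finite \<D>" "\<D> \<subseteq> \<C>" "\<F> - {W} = (\<lambda>T. topspace X - (M - T)) ` \<D>"
        using finite_subset_image[of "\<F> - {W}" "\<lambda>T. topspace X - (M - T)" \<C>] \<F>(1,2) by blast
      obtain T where T: "T \<in> \<C>" "\<Union>\<D> \<subseteq> T"
      proof (cases "\<D> = {}")
        case True
        then show ?thesis
          using that ne by blast
      next
        case False
        have "subset.chain \<A> \<D>"
          using ch \<D>(2) unfolding subset.chain_def by blast
        then have "\<Union>\<D> \<in> \<D>"
          using Union_in_chain \<D>(1) False by blast
        then show ?thesis using that \<D> by blast
      qed
      have "M - T \<subseteq> W"
        using \<F>(3) \<D>(3) T(2) by blast
      then have "nonvanishing_on X (M - T) G"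
        using G(1) by (auto simp: nonvanishing_on_def W_def continuous_map_from_subtopology)
      moreover have "F \<subseteq> ?N"
        using sub F by (auto simp: \<A>_def)
      ultimately have "nonvanishing_extension X F f (M - T)"
        using G(2) gf unfolding nonvanishing_extension_def by (metis subsetD)
      then show False
        using T sub by (auto simp: \<A>_def)
    qed
    then show "\<Union>\<C> \<in> \<A>"
      using op sub F(2) unfolding \<A>_def by blast
  qed
  then obtain T where T: "T \<in> \<A>" and max: "\<And>S. S \<in> \<A> \<Longrightarrow> T \<subseteq> S \<Longrightarrow> S = T"
    by blast
  have T': "T \<subseteq> M" "F \<subseteq> M - T" "\<not> nonvanishing_extension X F f (M - T)"
    and opT: "openin X (topspace X - (M - T))"
    using T unfolding \<A>_def by blast+
  have clT: "closedin X (M - T)"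
    using opT Msub unfolding closedin_def by blast
  have "nonvanishing_extension X F f N" if N: "closedin X N" "F \<subseteq> N" "N \<subset> M - T" for N
  proof (rule ccontr)
    assume no: "\<not> nonvanishing_extension X F f N"
    have eq: "M - (M - N) = N"
      using N(3) by blast
    have "M - N \<in> \<A>"
      unfolding \<A>_def mem_Collect_eq eq using N(1,2) no by (simp add: openin_diff)
    moreover have "T \<subset> M - N"
      using N(3) T'(1) by blast
    ultimately show False
      using max by blast
  qed
  moreover have "compactin X (M - T)"
    using clT M(1) closed_compactin by blast
  ultimately have "membrane X F f (M - T)"
    unfolding membrane_def using T' F(1) f clT by blast
  then show ?thesis
    using that by blast
qed

section \<open>Homeomorphic images of membranes\<close>

lemma nonvanishing_on_homeomorphic:
  assumes hh: "homeomorphic_maps X X h h'" and S: "S \<subseteq> topspace X" and g: "nonvanishing_on X S g"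
  shows "nonvanishing_on X (h ` S) (g \<circ> h')"
proof -
  have inv: "h' (h x) = x" if "x \<in> S" for x
    using hh S that by (auto simp: homeomorphic_maps_def)
  have "homeomorphic_maps (subtopology X S) (subtopology X (h ` S)) h h'"
  proof (rule homeomorphic_maps_subtopologies[OF hh])
    have "h ` S \<subseteq> topspace X"
      using hh S by (auto simp: homeomorphic_maps_def continuous_map_def)
    then show "h ` (topspace X \<inter> S) = topspace X \<inter> h ` S"
      using S by (simp add: Int_absorb1)
  qed
  then show ?thesis
    using g inv unfolding nonvanishing_on_def homeomorphic_maps_def
    by (auto intro: continuous_map_compose)
qed

lemma nonvanishing_extension_homeomorphic:
  assumes hh: "homeomorphic_maps X X h h'" and S: "S \<subseteq> topspace X" "F \<subseteq> S"
    and ext: "nonvanishing_extension X F f S"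
  shows "nonvanishing_extension X (h ` F) (f \<circ> h') (h ` S)"
proof -
  obtain g where g: "nonvanishing_on X S g" "\<forall>x\<in>F. g x = f x"
    using ext by (auto simp: nonvanishing_extension_def)
  have "\<forall>x\<in>h ` F. (g \<circ> h') x = (f \<circ> h') x"
    using g hh S by (auto simp: homeomorphic_maps_def subset_iff)
  then show ?thesis
    using nonvanishing_on_homeomorphic[OF hh S(1) g(1)]
    unfolding nonvanishing_extension_def by blast
qed

lemma membrane_homeomorphic:
  assumes hh: "homeomorphic_maps X X h h'" and mem: "membrane X F f M"
  shows "membrane X (h ` F) (f \<circ> h') (h ` M)"
proof -
  have M: "compactin X M" "closedin X M" "closedin X F" "F \<subseteq> M" "nonvanishing_on X F f"
    and no_ext: "\<not> nonvanishing_extension X F f M"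
    and min: "\<And>N. closedin X N \<Longrightarrow> F \<subseteq> N \<Longrightarrow> N \<subset> M \<Longrightarrow> nonvanishing_extension X F f N"
    using mem unfolding membrane_def by auto
  have top: "M \<subseteq> topspace X" "F \<subseteq> topspace X"
    using M by (auto simp: closedin_subset)
  have inv: "\<And>x. x \<in> topspace X \<Longrightarrow> h' (h x) = x" "\<And>x. x \<in> topspace X \<Longrightarrow> h (h' x) = x"
    using hh by (auto simp: homeomorphic_maps_def)
  have h'h: "h' ` h ` S = S" if "S \<subseteq> topspace X" for S
    using inv that by (force simp: image_iff subset_iff)
  have hh'S: "h ` h' ` S = S" if "S \<subseteq> topspace X" for S
    using inv that by (force simp: image_iff subset_iff)
  have hm: "homeomorphic_map X X h" "homeomorphic_map X X h'" and hh': "homeomorphic_maps X X h' h"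
    using hh homeomorphic_maps_map homeomorphic_maps_sym by blast+
  have ext_back: "nonvanishing_extension X F f S"
    if "nonvanishing_extension X (h ` F) (f \<circ> h') (h ` S)" "S \<subseteq> topspace X" "F \<subseteq> S" for S
  proof -
    have "h ` S \<subseteq> topspace X"
      using hm that by (metis homeomorphic_imp_surjective_map image_mono)
    from nonvanishing_extension_homeomorphic[OF hh' this _ that(1)] that
    have "nonvanishing_extension X F ((f \<circ> h') \<circ> h) S"
      by (simp add: h'h top image_mono)
    then show ?thesis
      using inv top unfolding nonvanishing_extension_def by (auto simp: subset_iff)
  qed
  show ?thesis
    unfolding membrane_def
  proof (intro conjI allI impI)
    show "compactin X (h ` M)"
      using M hm by (meson compactin_subset_topspace homeomorphic_map_compactness)
    show "closedin X (h ` M)" "closedin X (h ` F)"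
      using M hm top by (meson homeomorphic_map_closedness)+
    show "nonvanishing_on X (h ` F) (f \<circ> h')"
      using nonvanishing_on_homeomorphic[OF hh] M top by blast
    show "\<not> nonvanishing_extension X (h ` F) (f \<circ> h') (h ` M)"
      using ext_back no_ext M top by blast
    fix N assume N: "closedin X N \<and> h ` F \<subseteq> N \<and> N \<subset> h ` M"
    then have Nt: "N \<subseteq> topspace X"
      by (simp add: closedin_subset)
    have "closedin X (h' ` N)"
      using N Nt hm by (meson homeomorphic_map_closedness)
    moreover have "F \<subseteq> h' ` N"
      using N h'h top by (metis image_mono)
    moreover have "h' ` N \<subset> M"
    proof -
      have "h' ` N \<subseteq> M"
        using N h'h top by (metis image_mono psubset_imp_subset)
      moreover have "h' ` N \<noteq> M"
        using N hh'S Nt by blast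
      ultimately show ?thesis by blast
    qed
    ultimately have "nonvanishing_extension X F f (h' ` N)"
      by (rule min)
    moreover have "h' ` N \<subseteq> topspace X" "F \<subseteq> h' ` N"
      using \<open>h' ` N \<subset> M\<close> \<open>F \<subseteq> h' ` N\<close> top by auto
    ultimately have "nonvanishing_extension X (h ` F) (f \<circ> h') (h ` h' ` N)"
      using nonvanishing_extension_homeomorphic[OF hh] by blast
    then show "nonvanishing_extension X (h ` F) (f \<circ> h') N"
      by (simp add: hh'S Nt)
  qed (use M in blast)
qed

lemma membrane_cong:
  assumes "membrane X F f M" "\<And>x. x \<in> F \<Longrightarrow> f x = f' x"
  shows "membrane X F f' M"
  using assms nonvanishing_on_cong[of X F f f']
  unfolding membrane_def nonvanishing_extension_def by auto

text \<open>Lets a membrane be moved without any change of its boundary data, so that several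
  motions can follow each other with the same \<open>F\<close> and \<open>f\<close>.\<close>

lemma membrane_homeomorphic_fixing:
  assumes h: "homeomorphic_map X X h" and fixF: "\<And>x. x \<in> F \<Longrightarrow> h x = x"
    and mem: "membrane X F f M"
  shows "membrane X F f (h ` M)"
proof -
  obtain h' where hh: "homeomorphic_maps X X h h'"
    using h by (auto simp: homeomorphic_map_maps)
  have "F \<subseteq> topspace X"
    using mem by (auto simp: membrane_def closedin_subset)
  then have "h' x = x" if "x \<in> F" for x
    using that fixF hh by (metis homeomorphic_maps_def subsetD)
  moreover have "h ` F = F"
    using fixF by force
  ultimately show ?thesis
    using membrane_homeomorphic[OF hh mem] by (auto intro: membrane_cong)
qed

section \<open>Covering dimension one\<close>

text \<open>The classical extension criterion for dimension at most one, with the circle replaced by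
  the punctured plane, which retracts onto it.\<close>

definition nonvanishing_extensor :: "'a topology \<Rightarrow> bool"
  where "nonvanishing_extensor X \<longleftrightarrow>
    (\<forall>F f. closedin X F \<and> nonvanishing_on X F f \<longrightarrow> nonvanishing_extension X F f (topspace X))"

lemma normal_space_bump:
  assumes X: "normal_space X" and "closedin X C" "openin X U" "C \<subseteq> U"
  obtains \<phi> where "continuous_map X euclideanreal \<phi>" "\<And>x. x \<in> topspace X \<Longrightarrow> 0 \<le> \<phi> x"
    "\<And>x. x \<in> topspace X - U \<Longrightarrow> \<phi> x = 0" "\<And>x. x \<in> C \<Longrightarrow> 0 < \<phi> x"
proof -
  have "closedin X (topspace X - U)" "disjnt (topspace X - U) C"
    using assms by (auto simp: disjnt_def)
  then obtain \<phi> where \<phi>: "continuous_map X (top_of_set {0..1}) \<phi>"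
      "\<phi> ` (topspace X - U) \<subseteq> {0}" "\<phi> ` C \<subseteq> {1::real}"
    using Urysohn_lemma[OF X, of "topspace X - U" C 0 1] assms by auto
  then have "0 \<le> \<phi> x" if "x \<in> topspace X" for x
    using that by (auto simp: continuous_map_def Pi_iff)
  moreover have "continuous_map X euclideanreal \<phi>"
    using \<phi> by (simp add: continuous_map_in_subtopology)
  ultimately show ?thesis
    using that[of \<phi>] \<phi> by fastforce
qed

text \<open>Up to scaling, the functions \<open>a\<close>, \<open>b\<close>, \<open>c\<close> below are the barycentric coordinates of a map to a
  triangle, which misses the centre on the preimage \<open>E\<close> of the boundary. Hence the pair \<open>w\<close> of
  coordinate differences has a nonvanishing extension from \<open>E\<close> to the whole space, and the new sets
  are those on which the respective coordinate is not minimal.\<close>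

lemma shrink_three_cover:
  assumes X: "normal_space X" and ext: "nonvanishing_extensor X"
    and op: "openin X A" "openin X B" "openin X C" and cov: "A \<union> B \<union> C = topspace X"
  obtains A' B' C' where "openin X A'" "openin X B'" "openin X C'" "A' \<subseteq> A" "B' \<subseteq> B" "C' \<subseteq> C"
    "A' \<union> B' \<union> C' = topspace X" "A' \<inter> B' \<inter> C' = {}"
proof -
  have sub: "A \<subseteq> topspace X" "B \<subseteq> topspace X" "C \<subseteq> topspace X"
    using cov by auto
  have pos: "openin X {x \<in> topspace X. 0 < \<phi> x}" if "continuous_map X euclideanreal \<phi>" for \<phi>
    using openin_continuous_map_preimage[OF that, of "{0<..}"] by (simp flip: open_openin)
  \<comment> \<open>The functions are chosen one after another: \<open>c\<close> is positive
    wherever \<open>A\<close> and \<open>B\<close> fail to cover, \<open>b\<close> wherever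
    \<open>A\<close> and the positivity set of \<open>c\<close> fail, and \<open>a\<close> wherever
    the positivity sets of \<open>b\<close> and \<open>c\<close> fail. Thus at each point one of
    them is positive, and each vanishes off its own set.\<close>
  obtain c where c: "continuous_map X euclideanreal c" "\<And>x. x \<in> topspace X \<Longrightarrow> 0 \<le> c x"
    "\<And>x. x \<in> topspace X - C \<Longrightarrow> c x = 0" "\<And>x. x \<in> topspace X - (A \<union> B) \<Longrightarrow> 0 < c x"
    using normal_space_bump[OF X, of "topspace X - (A \<union> B)" C] op cov by (metis Diff_subset_conv
        closedin_topspace closedin_diff openin_Un equalityE)
  obtain b where b: "continuous_map X euclideanreal b" "\<And>x. x \<in> topspace X \<Longrightarrow> 0 \<le> b x"
    "\<And>x. x \<in> topspace X - B \<Longrightarrow> b x = 0"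
    "\<And>x. x \<in> topspace X - (A \<union> {x \<in> topspace X. 0 < c x}) \<Longrightarrow> 0 < b x"
  proof (rule normal_space_bump[OF X])
    show "closedin X (topspace X - (A \<union> {x \<in> topspace X. 0 < c x}))"
      using op pos[OF c(1)] by (intro closedin_diff closedin_topspace openin_Un)
    show "topspace X - (A \<union> {x \<in> topspace X. 0 < c x}) \<subseteq> B"
      using c(4) by blast
  qed (use op in auto)
  obtain a where a: "continuous_map X euclideanreal a" "\<And>x. x \<in> topspace X \<Longrightarrow> 0 \<le> a x"
    "\<And>x. x \<in> topspace X - A \<Longrightarrow> a x = 0"
    "\<And>x. x \<in> topspace X - ({x \<in> topspace X. 0 < b x} \<union> {x \<in> topspace X. 0 < c x}) \<Longrightarrow> 0 < a x"
  proof (rule normal_space_bump[OF X])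
    show "closedin X (topspace X - ({x \<in> topspace X. 0 < b x} \<union> {x \<in> topspace X. 0 < c x}))"
      using pos[OF b(1)] pos[OF c(1)] by (intro closedin_diff closedin_topspace openin_Un)
    show "topspace X - ({x \<in> topspace X. 0 < b x} \<union> {x \<in> topspace X. 0 < c x}) \<subseteq> A"
      using b(4) by blast
  qed (use op in auto)
  have sum_pos: "0 < a x + b x + c x" if "x \<in> topspace X" for x
  proof (cases "0 < b x \<or> 0 < c x")
    case True
    then show ?thesis
      using that a(2)[OF that] b(2)[OF that] c(2)[OF that] by auto
  next
    case False
    then show ?thesis
      using that a(4)[of x] b(2)[OF that] c(2)[OF that] by auto
  qed
  define E where "E = {x \<in> topspace X. a x * b x * c x = 0}"
  have clE: "closedin X E"
  proof -
    have "continuous_map X euclideanreal (\<lambda>x. a x * b x * c x)"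
      using a b c by (intro continuous_map_real_mult)
    from closedin_continuous_map_preimage[OF this, of "{0}"] show ?thesis
      by (simp add: E_def)
  qed
  define w where "w = (\<lambda>x. Complex (a x - c x) (b x - c x))"
  have "continuous_map X euclidean w"
    unfolding w_def using a b c by (simp add: continuous_map_atin tendsto_Complex tendsto_diff)
  \<comment> \<open>A zero of \<open>w\<close> would make \<open>a\<close>, \<open>b\<close>,
    \<open>c\<close> equal; on \<open>E\<close> their product vanishes, so all three would be zero,
    against \<open>sum_pos\<close>.\<close>
  moreover have "w x \<noteq> 0" if "x \<in> E" for x
    using that sum_pos[of x] by (auto simp: E_def w_def complex_eq_iff)
  ultimately have "nonvanishing_on X E w"
    by (simp add: nonvanishing_on_def continuous_map_from_subtopology)
  then obtain g where g: "nonvanishing_on X (topspace X) g" "\<And>x. x \<in> E \<Longrightarrow> g x = w x"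
    using ext clE unfolding nonvanishing_extensor_def nonvanishing_extension_def by blast
  have gc: "continuous_map X euclidean g" and g0: "\<And>x. x \<in> topspace X \<Longrightarrow> g x \<noteq> 0"
    using g by (auto simp: nonvanishing_on_def)
  \<comment> \<open>\<open>Re (g x)\<close>, \<open>Im (g x)\<close> and \<open>0\<close> serve as
    the three coordinates up to a common shift, and \<open>?m\<close> is the least of them. Some
    coordinate is always minimal, so the new sets have no common point; all three are minimal only
    where \<open>g\<close> vanishes, so the new sets cover.\<close>
  let ?m = "\<lambda>x. min (min (Re (g x)) (Im (g x))) 0"
  have open_pre: "openin X {x \<in> topspace X. ?m x < p (g x)}" if "continuous_on UNIV p" for p
  proof -
    have "open {z::complex. min (min (Re z) (Im z)) 0 < p z}"
      using that by (intro open_Collect_less continuous_intros)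
    from openin_continuous_map_preimage[OF gc, of "{z. min (min (Re z) (Im z)) 0 < p z}"] this
    show ?thesis by (simp flip: open_openin)
  qed
  define A' where "A' = {x \<in> topspace X. ?m x < Re (g x)}"
  define B' where "B' = {x \<in> topspace X. ?m x < Im (g x)}"
  define C' where "C' = {x \<in> topspace X. ?m x < 0}"
  have off: "x \<in> A \<inter> B \<inter> C" if "x \<in> topspace X" "x \<notin> E" for x
    using that a(3)[of x] b(3)[of x] c(3)[of x] by (auto simp: E_def)
  have on: "Re (g x) = a x - c x" "Im (g x) = b x - c x" "a x = 0 \<or> b x = 0 \<or> c x = 0"
    "0 \<le> a x" "0 \<le> b x" "0 \<le> c x" if "x \<in> E" for x
    using that a(2)[of x] b(2)[of x] c(2)[of x] by (auto simp: g(2) w_def E_def)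
  show ?thesis
  proof
    show "openin X A'" "openin X B'" "openin X C'"
      unfolding A'_def B'_def C'_def
      by (intro open_pre linear_continuous_on bounded_linear_Re bounded_linear_Im continuous_on_const)+
    show "A' \<subseteq> A"
    proof
      fix x assume x: "x \<in> A'"
      show "x \<in> A"
      proof (cases "x \<in> E")
        case True
        have "a x \<noteq> 0" using x on[OF True] by (auto simp: A'_def min_def split: if_splits)
        then show ?thesis using a(3)[of x] x by (auto simp: A'_def)
      qed (use x off in \<open>auto simp: A'_def\<close>)
    qed
    show "B' \<subseteq> B"
    proof
      fix x assume x: "x \<in> B'"
      show "x \<in> B"
      proof (cases "x \<in> E")
        case True
        have "b x \<noteq> 0" using x on[OF True] by (auto simp: B'_def min_def split: if_splits)
        then show ?thesis using b(3)[of x] x by (auto simp: B'_def)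
      qed (use x off in \<open>auto simp: B'_def\<close>)
    qed
    show "C' \<subseteq> C"
    proof
      fix x assume x: "x \<in> C'"
      show "x \<in> C"
      proof (cases "x \<in> E")
        case True
        have "c x \<noteq> 0" using x on[OF True] by (auto simp: C'_def min_def split: if_splits)
        then show ?thesis using c(3)[of x] x by (auto simp: C'_def)
      qed (use x off in \<open>auto simp: C'_def\<close>)
    qed
    show "A' \<union> B' \<union> C' = topspace X"
    proof
      show "topspace X \<subseteq> A' \<union> B' \<union> C'"
      proof
        fix x assume x: "x \<in> topspace X"
        then have "Re (g x) \<noteq> 0 \<or> Im (g x) \<noteq> 0"
          using g0 by (auto simp: complex_eq_iff)
        then show "x \<in> A' \<union> B' \<union> C'"
          using x by (auto simp: A'_def B'_def C'_def min_def)
      qed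
    qed (auto simp: A'_def B'_def C'_def)
    show "A' \<inter> B' \<inter> C' = {}"
      by (auto simp: A'_def B'_def C'_def min_def split: if_splits)
  qed
qed

text \<open>A finite cover is shrunk once for each pair \<open>(i, j)\<close> of distinct members:
  \<open>shrink_three_cover\<close> is applied to the sets at \<open>i\<close> and \<open>j\<close>
  and the union of all the others. Once all pairs are treated, no point lies in three sets with
  different indices.\<close>

lemma covering_dim_le_1I:
  assumes X: "normal_space X" and ext: "nonvanishing_extensor X"
  shows "covering_dim_le X 1"
  unfolding covering_dim_le_def
proof (intro conjI allI impI)
  fix \<U> assume \<U>: "finite \<U> \<and> (\<forall>U\<in>\<U>. openin X U) \<and> \<Union>\<U> = topspace X"
  define shrinking where "shrinking = (\<lambda>V Q.
    (\<forall>U\<in>\<U>. openin X (V U) \<and> V U \<subseteq> U) \<and> (\<Union>U\<in>\<U>. V U) = topspace X \<and>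
    (\<forall>i j k. (i, j) \<in> Q \<longrightarrow> k \<in> \<U> \<longrightarrow> k \<noteq> i \<longrightarrow> k \<noteq> j \<longrightarrow> V i \<inter> V j \<inter> V k = {}))"
  have shrinkingD: "U \<in> \<U> \<Longrightarrow> openin X (V U)" "U \<in> \<U> \<Longrightarrow> V U \<subseteq> U" "(\<Union>U\<in>\<U>. V U) = topspace X"
      "(i, j) \<in> Q \<Longrightarrow> k \<in> \<U> \<Longrightarrow> k \<noteq> i \<Longrightarrow> k \<noteq> j \<Longrightarrow> V i \<inter> V j \<inter> V k = {}"
    if "shrinking V Q" for V Q U i j k
    using that unfolding shrinking_def by simp_all
  have shrink: "\<exists>V. shrinking V Q"
    if "finite Q" "Q \<subseteq> {(i, j). i \<in> \<U> \<and> j \<in> \<U> \<and> i \<noteq> j}" for Q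
    using that
  proof (induction Q rule: finite_induct)
    case empty
    then show ?case
      using \<U> unfolding shrinking_def by (intro exI[of _ "\<lambda>U. U"]) auto
  next
    case (insert q Q)
    obtain i j where q: "q = (i, j)" by (cases q)
    then have ij: "i \<in> \<U>" "j \<in> \<U>" "i \<noteq> j"
      using insert.prems by auto
    have "\<exists>V. shrinking V Q"
      using insert.prems by (intro insert.IH) simp
    then obtain V where "shrinking V Q" ..
    note V = shrinkingD[OF this]
    have "openin X (\<Union>U\<in>\<U> - {i, j}. V U)"
      using V(1) by auto
    moreover have "V i \<union> V j \<union> (\<Union>U\<in>\<U> - {i, j}. V U) = topspace X"
      using V(3) ij by blast
    ultimately obtain A B C where ABC: "openin X A" "openin X B" "openin X C" "A \<subseteq> V i" "B \<subseteq> V j"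
      "C \<subseteq> (\<Union>U\<in>\<U> - {i, j}. V U)" "A \<union> B \<union> C = topspace X" "A \<inter> B \<inter> C = {}"
      using shrink_three_cover[OF X ext, of "V i" "V j"] V(1) ij by metis
    \<comment> \<open>Intersecting with \<open>C\<close> shrinks all the other sets at once; they
      still cover \<open>C\<close> because \<open>C\<close> lies in their union.\<close>
    define V' where "V' = (\<lambda>U. if U = i then A else if U = j then B else C \<inter> V U)"
    have sub: "V' U \<subseteq> V U" for U
      using ABC by (auto simp: V'_def)
    have "openin X (V' U)" if "U \<in> \<U>" for U
      using ABC V that by (auto simp: V'_def)
    moreover have "(\<Union>U\<in>\<U>. V' U) = topspace X"
    proof
      show "(\<Union>U\<in>\<U>. V' U) \<subseteq> topspace X"
        using sub V(3) by blast
      show "topspace X \<subseteq> (\<Union>U\<in>\<U>. V' U)"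
      proof
        fix x assume "x \<in> topspace X"
        then consider "x \<in> A" | "x \<in> B" | "x \<in> C"
          using ABC(7) by blast
        then show "x \<in> (\<Union>U\<in>\<U>. V' U)"
        proof cases
          case 3
          then obtain U where "U \<in> \<U> - {i, j}" "x \<in> V U"
            using ABC(6) by blast
          with 3 show ?thesis by (auto simp: V'_def)
        qed (use ij in \<open>auto simp: V'_def\<close>)
      qed
    qed
    moreover have "V' i' \<inter> V' j' \<inter> V' k = {}"
      if "(i', j') \<in> insert q Q" "k \<in> \<U>" "k \<noteq> i'" "k \<noteq> j'" for i' j' k
    proof (cases "(i', j') = q")
      case True
      then show ?thesis
        using q that ij ABC(8) by (auto simp: V'_def)
    next
      case False
      then show ?thesis
        using that V(4)[of i' j' k] sub by blast
    qed
    ultimately show ?case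
      using subset_trans[OF sub V(2)] unfolding shrinking_def by (intro exI[of _ V'] conjI) simp_all
  qed
  define Q where "Q = {(i, j). i \<in> \<U> \<and> j \<in> \<U> \<and> i \<noteq> j}"
  have "finite Q"
    by (rule finite_subset[of _ "\<U> \<times> \<U>"]) (use \<U> in \<open>auto simp: Q_def\<close>)
  then have "\<exists>V. shrinking V Q"
    by (intro shrink) (simp_all add: Q_def)
  then obtain V where "shrinking V Q" ..
  note V = shrinkingD[OF this]
  show "\<exists>\<V>. finite \<V> \<and> (\<forall>V\<in>\<V>. openin X V) \<and> \<Union>\<V> = topspace X \<and>
        (\<forall>V\<in>\<V>. \<exists>U\<in>\<U>. V \<subseteq> U) \<and>
        (\<forall>x\<in>topspace X. int (card {V \<in> \<V>. x \<in> V}) \<le> 1 + 1)"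
  proof (intro exI conjI ballI)
    fix x assume "x \<in> topspace X"
    let ?I = "{U \<in> \<U>. x \<in> V U}"
    \<comment> \<open>The bound is proved for indices. Several indices may carry the same set, which
      only lowers the number of distinct members.\<close>
    have "card ?I \<le> 2"
    proof (rule ccontr)
      assume "\<not> card ?I \<le> 2"
      then have "3 \<le> card ?I" by simp
      then obtain T where T: "T \<subseteq> ?I" "card T = 3"
        by (meson obtain_subset_with_card_n)
      then obtain i j k where "T = {i, j, k}" "i \<noteq> j" "i \<noteq> k" "j \<noteq> k"
        by (auto simp: card_3_iff)
      then have "(i, j) \<in> Q" "k \<in> \<U>" "k \<noteq> i" "k \<noteq> j" "x \<in> V i \<inter> V j \<inter> V k"
        using T by (auto simp: Q_def)
      then show False
        using V(4) by blast
    qed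
    moreover have "{W \<in> V ` \<U>. x \<in> W} = V ` ?I"
      by auto
    moreover have "card (V ` ?I) \<le> card ?I"
      using \<U> by (intro card_image_le) simp
    ultimately have "card {W \<in> V ` \<U>. x \<in> W} \<le> 2"
      by simp
    then show "int (card {W \<in> V ` \<U>. x \<in> W}) \<le> 1 + 1"
      by simp
  next
    show "\<Union>(V ` \<U>) = topspace X"
      by (fact V(3))
    show "openin X W" if "W \<in> V ` \<U>" for W
      using that V(1) by blast
    show "\<exists>U\<in>\<U>. W \<subseteq> U" if "W \<in> V ` \<U>" for W
      using that V(2) by blast
  qed (use \<U> in simp)
qed simp

lemma covering_dim_le_mono:
  assumes "covering_dim_le X m" "m \<le> n"
  shows "covering_dim_le X n"
  unfolding covering_dim_le_def
proof (intro conjI allI impI)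
  show "-1 \<le> n"
    using assms by (simp add: covering_dim_le_def)
  fix \<U> assume "finite \<U> \<and> (\<forall>U\<in>\<U>. openin X U) \<and> \<Union>\<U> = topspace X"
  from assms(1)[unfolded covering_dim_le_def, THEN conjunct2, THEN spec, THEN mp, OF this]
  obtain \<V> where "finite \<V> \<and> (\<forall>V\<in>\<V>. openin X V) \<and> \<Union>\<V> = topspace X \<and>
      (\<forall>V\<in>\<V>. \<exists>U\<in>\<U>. V \<subseteq> U)" and ord: "\<forall>x\<in>topspace X. int (card {V \<in> \<V>. x \<in> V}) \<le> m + 1"
    by (elim exE conjE) simp
  moreover have "\<forall>x\<in>topspace X. int (card {V \<in> \<V>. x \<in> V}) \<le> n + 1"
    using ord assms(2) by force
  ultimately show "\<exists>\<V>. finite \<V> \<and> (\<forall>V\<in>\<V>. openin X V) \<and> \<Union>\<V> = topspace X \<and>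
      (\<forall>V\<in>\<V>. \<exists>U\<in>\<U>. V \<subseteq> U) \<and> (\<forall>x\<in>topspace X. int (card {V \<in> \<V>. x \<in> V}) \<le> n + 1)"
    by (intro exI[of _ \<V>]) simp
qed

section \<open>Reduction of the extension property to compact sets\<close>

lemma second_countable_if_separable_metrizable:
  assumes "metrizable_space X" "separable_space X"
  shows "second_countable X"
proof -
  obtain M d where M: "Metric_space M d" and X: "X = Metric_space.mtopology M d"
    using assms(1) unfolding metrizable_space_def by blast
  interpret Metric_space M d by (fact M)
  obtain C where C: "countable C" "C \<subseteq> M" "mtopology closure_of C = M"
    using assms(2) unfolding separable_space_def X by auto
  define \<B> where "\<B> = (\<lambda>(c, n). mball c (inverse (real (Suc n)))) ` (C \<times> UNIV)"
  show ?thesis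
    unfolding second_countable_def
  proof (intro exI[of _ \<B>] conjI allI impI)
    show "countable \<B>"
      using C by (auto simp: \<B>_def)
    show "\<forall>V\<in>\<B>. openin X V"
      by (auto simp: \<B>_def X openin_mball)
    fix U x assume "openin X U \<and> x \<in> U"
    then have "x \<in> M" and "\<exists>r>0. mball x r \<subseteq> U"
      unfolding X openin_mtopology by auto
    then obtain r where r: "r > 0" "mball x r \<subseteq> U" by blast
    obtain n where n: "inverse (real (Suc n)) < r / 2"
      using reals_Archimedean[of "r / 2"] r(1) by auto
    let ?e = "inverse (real (Suc n))"
    have "x \<in> mtopology closure_of C"
      using C(3) \<open>x \<in> M\<close> by simp
    then obtain c where c: "c \<in> C" "c \<in> mball x ?e"
      unfolding metric_closure_of by (auto elim!: allE[of _ ?e])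
    have "mball c ?e \<subseteq> mball x r"
    proof
      fix z assume z: "z \<in> mball c ?e"
      then have "d x z \<le> d x c + d c z"
        using c \<open>x \<in> M\<close> triangle[of x c z] by auto
      then show "z \<in> mball x r"
        using c z n by auto
    qed
    then have "x \<in> mball c ?e" "mball c ?e \<subseteq> U"
      using c r(2) by (auto simp: commute)
    moreover have "mball c ?e \<in> \<B>"
      using c(1) by (auto simp: \<B>_def)
    ultimately show "\<exists>V\<in>\<B>. x \<in> V \<and> V \<subseteq> U" by blast
  qed
qed

lemma locally_compact_Lindelof_exhaustion:
  assumes "locally_compact_space X" "Lindelof_space X"
  obtains U K :: "nat \<Rightarrow> 'a set" where "\<And>n. openin X (U n)" "\<And>n. compactin X (K n)"
    "\<And>n. U n \<subseteq> K n" "(\<Union>n. U n) = topspace X"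
proof -
  let ?\<U> = "{U. openin X U \<and> (\<exists>K. compactin X K \<and> U \<subseteq> K)}"
  have "\<Union>?\<U> = topspace X"
    using assms(1) unfolding locally_compact_space_def
    by (auto dest: openin_subset[THEN subsetD]) blast
  then obtain \<V> where \<V>: "countable \<V>" "\<V> \<subseteq> ?\<U>" "\<Union>\<V> = topspace X"
    using Lindelof_spaceD[OF assms(2), of ?\<U>] by (smt (verit) mem_Collect_eq)
  \<comment> \<open>Inserting the empty set makes the countable family nonempty, so that it has an
    enumeration even when the space is empty.\<close>
  define U where "U = from_nat_into (insert {} \<V>)"
  have range: "range U = insert {} \<V>"
    unfolding U_def using \<V>(1) by (intro range_from_nat_into) auto
  then have "\<forall>n. U n \<in> insert {} \<V>"
    by blast
  then have U: "openin X (U n) \<and> (\<exists>K. compactin X K \<and> U n \<subseteq> K)" for n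
    using \<V>(2) by (cases "U n = {}") auto
  then obtain K where "\<And>n. compactin X (K n) \<and> U n \<subseteq> K n"
    by metis
  moreover have "(\<Union>n. U n) = topspace X"
    using range \<V>(3) by simp
  ultimately show ?thesis
    using that[of U K] U by simp
qed

text \<open>The extension grows by one compact set \<open>K n\<close> at a time, with the values
  already found prescribed on part of \<open>K n\<close>. Since the open sets \<open>U n\<close>
  inside the \<open>K n\<close> cover the space, the union of the partial extensions is
  continuous.\<close>

lemma nonvanishing_extensor_if_compact:
  assumes X: "normal_space X" "Hausdorff_space X" "locally_compact_space X" "Lindelof_space X"
    and ext: "\<And>K F f. compactin X K \<Longrightarrow> closedin X F \<Longrightarrow> F \<subseteq> K \<Longrightarrow> nonvanishing_on X F f \<Longrightarrow>
      nonvanishing_extension X F f K"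
  shows "nonvanishing_extensor X"
  unfolding nonvanishing_extensor_def
proof (intro allI impI)
  fix F f assume F: "closedin X F \<and> nonvanishing_on X F f"
  obtain U K :: "nat \<Rightarrow> 'a set" where UK: "\<And>n. openin X (U n)" "\<And>n. compactin X (K n)"
      "\<And>n. U n \<subseteq> K n" "(\<Union>n. U n) = topspace X"
    using locally_compact_Lindelof_exhaustion[OF X(3,4)] by blast
  have clK: "closedin X (K n)" for n
    using UK(2) X(2) compactin_imp_closedin by blast
  \<comment> \<open>With the strict bound \<open>i<n\<close>, \<open>Q 0\<close> is
    \<open>F\<close>, so the recursion starts from \<open>f\<close>; accordingly the values on
    \<open>U n\<close> are read off from \<open>g (Suc n)\<close>.\<close>
  define Q where "Q = (\<lambda>n. F \<union> (\<Union>i<n. K i))"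
  have clQ: "closedin X (Q n)" for n
    unfolding Q_def using F clK by (intro closedin_Un closedin_Union) auto
  have QSuc: "Q (Suc n) = Q n \<union> K n" for n
    by (auto simp: Q_def less_Suc_eq)
  have "\<exists>g. \<forall>n. (nonvanishing_on X (Q n) (g n) \<and> (\<forall>x\<in>F. g n x = f x)) \<and>
      (\<forall>x\<in>Q n. g (Suc n) x = g n x)"
  proof (rule dependent_nat_choice)
    show "\<exists>g. nonvanishing_on X (Q 0) g \<and> (\<forall>x\<in>F. g x = f x)"
      using F by (auto simp: Q_def)
    fix g n assume g: "nonvanishing_on X (Q n) g \<and> (\<forall>x\<in>F. g x = f x)"
    have "nonvanishing_on X (Q n \<inter> K n) g"
      using g by (auto intro: nonvanishing_on_subset)
    then have "nonvanishing_extension X (Q n \<inter> K n) g (K n)"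
      using ext[OF UK(2)] clQ clK by (meson closedin_Int inf_le2)
    then obtain k where k: "nonvanishing_on X (K n) k" "\<forall>x\<in>Q n \<inter> K n. k x = g x"
      by (auto simp: nonvanishing_extension_def)
    have eq: "g x = k x" if "x \<in> Q n" "x \<in> K n" for x
      using k(2) that by simp
    obtain g' where g': "nonvanishing_on X (Q n \<union> K n) g'"
      "\<And>x. x \<in> Q n \<Longrightarrow> g' x = g x" "\<And>x. x \<in> K n \<Longrightarrow> g' x = k x"
      using nonvanishing_pasting[of X "Q n" "K n" g k] clQ clK g k(1) eq by blast
    have "\<forall>x\<in>F. g' x = f x"
      using g g'(2) by (auto simp: Q_def)
    with g' show "\<exists>g'. (nonvanishing_on X (Q (Suc n)) g' \<and> (\<forall>x\<in>F. g' x = f x)) \<and>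
        (\<forall>x\<in>Q n. g' x = g x)"
      unfolding QSuc by blast
  qed
  then obtain g where g: "\<And>n. nonvanishing_on X (Q n) (g n)" "\<And>n x. x \<in> F \<Longrightarrow> g n x = f x"
      "\<And>n x. x \<in> Q n \<Longrightarrow> g (Suc n) x = g n x"
    by blast
  have Qmono: "Q m \<subseteq> Q n" if "m \<le> n" for m n
    using that by (force simp: Q_def)
  have stable: "g n x = g m x" if "m \<le> n" "x \<in> Q m" for m n x
    using that(1)
  proof (induction n rule: dec_induct)
    case (step n)
    then show ?case
      using g(3)[of x n] Qmono[of m n] that(2) by auto
  qed simp
  have UQ: "U n \<subseteq> Q (Suc n)" for n
    using UK(3)[of n] by (auto simp: Q_def)
  have agree: "g (Suc i) x = g (Suc j) x" if "x \<in> U i" "x \<in> U j" for i j x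
    using stable[of "Suc i" "Suc j" x] stable[of "Suc j" "Suc i" x] subsetD[OF UQ] that
    by (metis Suc_le_mono nle_le)
  obtain G where G: "continuous_map X euclidean G"
      "\<And>x i. i \<in> UNIV \<Longrightarrow> x \<in> topspace X \<inter> U i \<Longrightarrow> G x = g (Suc i) x"
  proof (rule pasting_lemma_exists[where X = X and I = UNIV and T = U and Y = euclidean and f = "\<lambda>i. g (Suc i)"])
    show "continuous_map (subtopology X (U i)) euclidean (g (Suc i))" for i
      using nonvanishing_on_subset[OF g(1) UQ] by (simp add: nonvanishing_on_def)
  qed (use UK agree in auto)
  have "\<exists>i. x \<in> topspace X \<inter> U i" if "x \<in> topspace X" for x
    using that UK(4) by auto
  then have "\<exists>i. x \<in> Q (Suc i) \<and> G x = g (Suc i) x" if "x \<in> topspace X" for x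
    using that G(2) UQ by blast
  moreover have "g (Suc i) x \<noteq> 0" if "x \<in> Q (Suc i)" for i x
    using g(1)[of "Suc i"] that by (auto simp: nonvanishing_on_def)
  ultimately have "G x \<noteq> 0" if "x \<in> topspace X" for x
    using that by metis
  moreover have "G x = f x" if "x \<in> F" for x
    using that F \<open>\<And>x. x \<in> topspace X \<Longrightarrow> \<exists>i. x \<in> Q (Suc i) \<and> G x = g (Suc i) x\<close> g(2) closedin_subset
    by (metis subsetD)
  ultimately show "nonvanishing_extension X F f (topspace X)"
    using G(1) unfolding nonvanishing_extension_def nonvanishing_on_def by auto
qed

section \<open>Strong local homogeneity\<close>

definition homogeneous_open :: "'a topology \<Rightarrow> 'a set \<Rightarrow> bool"
  where "homogeneous_open X U \<longleftrightarrow> openin X U \<and>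
    (\<forall>y\<in>U. \<forall>z\<in>U. \<exists>h. homeomorphic_map X X h \<and> h y = z \<and> (\<forall>p \<in> topspace X - U. h p = p))"

lemma homogeneous_openE:
  assumes "homogeneous_open X U" "y \<in> U" "z \<in> U"
  obtains h where "homeomorphic_map X X h" "h y = z" "\<And>p. p \<in> topspace X \<Longrightarrow> p \<notin> U \<Longrightarrow> h p = p"
proof -
  from assms(1) have "\<forall>y\<in>U. \<forall>z\<in>U. \<exists>h. homeomorphic_map X X h \<and> h y = z \<and> (\<forall>p \<in> topspace X - U. h p = p)"
    unfolding homogeneous_open_def by (rule conjunct2)
  from this[THEN bspec, OF assms(2), THEN bspec, OF assms(3)]
  obtain h where h: "homeomorphic_map X X h" "h y = z" "\<forall>p \<in> topspace X - U. h p = p"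
    by (elim exE conjE)
  show ?thesis
    by (rule that[of h]) (use h in simp_all)
qed
lemma strongly_locally_homogeneous_iff:
  "strongly_locally_homogeneous X \<longleftrightarrow>
    (\<forall>x W. openin X W \<and> x \<in> W \<longrightarrow> (\<exists>U. homogeneous_open X U \<and> x \<in> U \<and> U \<subseteq> W))"
proof -
  have "homogeneous_open X U \<and> x \<in> U \<and> U \<subseteq> W \<longleftrightarrow> openin X U \<and> x \<in> U \<and> U \<subseteq> W \<and>
      (\<forall>y\<in>U. \<forall>z\<in>U. \<exists>h. homeomorphic_map X X h \<and> h y = z \<and> (\<forall>p \<in> topspace X - U. h p = p))"
    for x U W
    unfolding homogeneous_open_def by argo
  then show ?thesis
    unfolding strongly_locally_homogeneous_def by simp
qed

lemma strongly_locally_homogeneousE: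
  assumes "strongly_locally_homogeneous X" "openin X W" "x \<in> W"
  obtains U where "homogeneous_open X U" "x \<in> U" "U \<subseteq> W"
proof -
  have "\<exists>U. homogeneous_open X U \<and> x \<in> U \<and> U \<subseteq> W"
    using assms unfolding strongly_locally_homogeneous_iff by simp
  then obtain U where "homogeneous_open X U" "x \<in> U" "U \<subseteq> W"
    by (elim exE conjE)
  then show ?thesis
    by (rule that)
qed

text \<open>A homeomorphism that is the identity off \<open>U\<close> maps \<open>U\<close> into
  itself: a point leaving \<open>U\<close> would land on a fixed point, against injectivity. Hence
  it preserves \<open>G\<close> and restricts to it.\<close>

lemma homogeneous_open_subtopology:
  assumes U: "homogeneous_open X U" "U \<subseteq> G" and G: "openin X G"
  shows "homogeneous_open (subtopology X G) U"
proof -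
  let ?G = "subtopology X G"
  have "\<exists>h. homeomorphic_map ?G ?G h \<and> h y = z \<and> (\<forall>p \<in> topspace ?G - U. h p = p)"
    if yz: "y \<in> U" "z \<in> U" for y z
  proof -
    obtain h where h: "homeomorphic_map X X h" "h y = z"
        "\<And>p. p \<in> topspace X \<Longrightarrow> p \<notin> U \<Longrightarrow> h p = p"
      using homogeneous_openE[OF U(1) yz] by blast
    have inj: "inj_on h (topspace X)"
      using h(1) by (simp add: homeomorphic_eq_everything_map)
    have "h x \<in> G \<longleftrightarrow> x \<in> G" if x: "x \<in> topspace X" "h x \<in> topspace X" for x
    proof (cases "x \<in> U")
      case True
      have "h x \<in> U"
      proof (rule ccontr)
        assume "h x \<notin> U"
        then have "h (h x) = h x"
          using h(3) x by blast
        then have "h x = x"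
          using inj x by (auto dest: inj_onD)
        then show False
          using True \<open>h x \<notin> U\<close> by simp
      qed
      then show ?thesis
        using True U(2) by blast
    next
      case False
      then show ?thesis
        using h(3) x by simp
    qed
    then have "homeomorphic_map ?G ?G h"
      by (intro homeomorphic_map_subtopologies_alt h(1)) auto
    then show ?thesis
      using h(2,3) by auto
  qed
  then show ?thesis
    using U G unfolding homogeneous_open_def by (simp add: openin_open_subtopology)
qed

lemma strongly_locally_homogeneous_open_subset:
  assumes slh: "strongly_locally_homogeneous X" and G: "openin X G"
  shows "strongly_locally_homogeneous (subtopology X G)"
  unfolding strongly_locally_homogeneous_iff
proof (intro allI impI)
  fix x W assume "openin (subtopology X G) W \<and> x \<in> W"
  then have W: "openin X W" "W \<subseteq> G" "x \<in> W"
    using G by (simp_all add: openin_open_subtopology)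
  then obtain U where U: "homogeneous_open X U" "x \<in> U" "U \<subseteq> W"
    using slh unfolding strongly_locally_homogeneous_iff by blast
  with W(2) have "homogeneous_open (subtopology X G) U"
    by (intro homogeneous_open_subtopology G) auto
  with U show "\<exists>U. homogeneous_open (subtopology X G) U \<and> x \<in> U \<and> U \<subseteq> W"
    by blast
qed

text \<open>The orbit of \<open>x\<close> under homeomorphisms of \<open>X\<close> is open and
  closed, since a homogeneous open set that meets it is contained in it.\<close>

lemma connected_strongly_locally_homogeneous_transitive:
  assumes slh: "strongly_locally_homogeneous X" and conn: "connected_space X"
    and x: "x \<in> topspace X" and y: "y \<in> topspace X"
  obtains h where "homeomorphic_map X X h" "h x = y"
proof -
  define S where "S = {z \<in> topspace X. \<exists>h. homeomorphic_map X X h \<and> h x = z}"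
  have nbhd: "\<exists>U. openin X U \<and> z \<in> U \<and> (U \<subseteq> S \<or> U \<subseteq> topspace X - S)"
    if z: "z \<in> topspace X" for z
  proof -
    obtain U where hU: "homogeneous_open X U" and "z \<in> U"
      using slh z unfolding strongly_locally_homogeneous_iff by blast
    then have U: "openin X U" "z \<in> U"
      by (simp_all add: homogeneous_open_def)
    have "w \<in> S" if vw: "v \<in> U" "w \<in> U" "v \<in> S" for v w
    proof -
      obtain k where k: "homeomorphic_map X X k" "k v = w"
        using homogeneous_openE[OF hU vw(1,2)] by blast
      obtain l where l: "homeomorphic_map X X l" "l x = v"
        using \<open>v \<in> S\<close> unfolding S_def by blast
      have "homeomorphic_map X X (k \<circ> l)" "(k \<circ> l) x = w"
        using k l homeomorphic_map_compose by auto
      moreover have "w \<in> topspace X"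
        using U(1) vw(2) openin_subset by blast
      ultimately show ?thesis
        unfolding S_def by blast
    qed
    then have "U \<subseteq> S \<or> U \<inter> S = {}"
      by blast
    then show ?thesis
      using U openin_subset by blast
  qed
  have "openin X S"
    unfolding openin_subopen[of X S] using nbhd unfolding S_def by blast
  moreover have "openin X (topspace X - S)"
    unfolding openin_subopen[of X "topspace X - S"] using nbhd by blast
  then have "closedin X S"
    by (simp add: closedin_def S_def)
  moreover have "x \<in> S"
    using x homeomorphic_map_id by (auto simp: S_def intro: exI[of _ id])
  ultimately have "S = topspace X"
    using conn unfolding connected_space_clopen_in by blast
  then show ?thesis
    using y that by (auto simp: S_def)
qed

text \<open>Dimension above one gives nonextendable boundary values on a compact set, hence a
  membrane. Since \<open>f\<close> extends over \<open>F\<close> itself, the membrane has a point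
  off \<open>F\<close>, and a homeomorphism carries this point to \<open>p\<close>.\<close>

lemma membrane_at:
  assumes "metrizable_space X" "separable_space X" "locally_compact_space X"
    and "strongly_locally_homogeneous X" "connected_space X" "\<not> covering_dim_le X 1"
    and p: "p \<in> topspace X"
  obtains F f M where "membrane X F f M" "p \<in> M" "p \<notin> F"
proof -
  have X: "normal_space X" "Hausdorff_space X" "Lindelof_space X"
    using assms metrizable_imp_normal_space metrizable_imp_Hausdorff_space
      second_countable_if_separable_metrizable second_countable_imp_Lindelof_space by blast+
  have "\<not> nonvanishing_extensor X"
    using covering_dim_le_1I X assms by blast
  then obtain K F f where K: "compactin X K" "closedin X F" "F \<subseteq> K" "nonvanishing_on X F f"
      "\<not> nonvanishing_extension X F f K"
    using nonvanishing_extensor_if_compact[OF X(1,2) assms(3) X(3)] by blast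
  then obtain M where M: "membrane X F f M"
    using membrane_exists[OF X(1)] compactin_imp_closedin[OF X(2)] by metis
  then have "M \<noteq> F"
    unfolding membrane_def nonvanishing_extension_def by blast
  then obtain k where k: "k \<in> M" "k \<notin> F"
    using M unfolding membrane_def by blast
  then have "k \<in> topspace X"
    using M unfolding membrane_def by (meson closedin_subset subsetD)
  then obtain h where h: "homeomorphic_map X X h" "h k = p"
    using connected_strongly_locally_homogeneous_transitive assms p by metis
  then obtain h' where "homeomorphic_maps X X h h'"
    by (auto simp: homeomorphic_map_maps)
  from membrane_homeomorphic[OF this M] have "membrane X (h ` F) (f \<circ> h') (h ` M)" .
  moreover have "p \<notin> h ` F"
  proof
    assume "p \<in> h ` F"
    then obtain z where "z \<in> F" "h z = h k"
      using h(2) by auto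
    moreover have "inj_on h (topspace X)"
      using h(1) by (simp add: homeomorphic_eq_everything_map)
    ultimately show False
      using k \<open>k \<in> topspace X\<close> K(2) by (metis closedin_subset inj_onD subsetD)
  qed
  ultimately show ?thesis
    using that k(1) h(2) by blast
qed

section \<open>Logarithms and separation of membranes\<close>

text \<open>Quantifying over all closed subsets makes the property hereditary, as is required when a
  membrane cuts an arbitrary closed set out of an arc.\<close>

definition has_logarithms :: "'a topology \<Rightarrow> 'a set \<Rightarrow> bool"
  where "has_logarithms X L \<longleftrightarrow>
    (\<forall>C c. closedin X C \<and> C \<subseteq> L \<and> nonvanishing_on X C c \<longrightarrow>
      (\<exists>\<phi>. continuous_map (subtopology X C) euclidean \<phi> \<and> (\<forall>x\<in>C. exp (\<phi> x) = c x)))"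

lemma has_logarithms_subset:
  "has_logarithms X L \<Longrightarrow> L' \<subseteq> L \<Longrightarrow> has_logarithms X L'"
  unfolding has_logarithms_def by blast

text \<open>A compact subset of the real line does not separate the plane, so it is Borsukian as a
  subset of the plane.\<close>

lemma continuous_logarithm_real:
  fixes c :: "real \<Rightarrow> complex"
  assumes C: "compact C" and c: "continuous_on C c" "\<And>t. t \<in> C \<Longrightarrow> c t \<noteq> 0"
  obtains \<phi> where "continuous_on C \<phi>" "\<And>t. t \<in> C \<Longrightarrow> exp (\<phi> t) = c t"
proof -
  let ?S = "complex_of_real ` C"
  have S: "compact ?S"
    using C by (intro compact_continuous_image continuous_intros)
  obtain B where B: "\<And>t. t \<in> C \<Longrightarrow> \<bar>t\<bar> \<le> B"
    using compact_imp_bounded[OF C] by (auto simp: bounded_real)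
  \<comment> \<open>The upper and lower half planes are joined by a half plane to the right of
    \<open>C\<close>. The union \<open>?T\<close> is connected and dense and misses
    \<open>?S\<close>, so the complement of \<open>?S\<close>, lying between \<open>?T\<close> and
    its closure, is connected.\<close>
  let ?T = "{z. 0 < Im z} \<union> ({z. B < Re z} \<union> {z. Im z < 0})"
  have "connected ?T"
  proof (intro connected_Un convex_connected convex_halfspace_Im_gt convex_halfspace_Re_gt
      convex_halfspace_Im_lt)
    have "Complex (B + 1) (-1) \<in> {z. B < Re z} \<inter> {z. Im z < 0}"
      by simp
    then show "{z. B < Re z} \<inter> {z. Im z < 0} \<noteq> {}" by blast
    have "Complex (B + 1) 1 \<in> {z. 0 < Im z} \<inter> ({z. B < Re z} \<union> {z. Im z < 0})"
      by simp
    then show "{z. 0 < Im z} \<inter> ({z. B < Re z} \<union> {z. Im z < 0}) \<noteq> {}" by blast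
  qed
  moreover have "?T \<subseteq> - ?S"
    using B by fastforce
  moreover have "z \<in> closure ?T" for z
  proof (cases "z \<in> ?T")
    case False
    then have "Im z = 0" by auto
    show ?thesis
      unfolding closure_approachable
    proof (intro allI impI)
      fix e :: real assume "0 < e"
      then have "dist (z + \<i> * of_real (e / 2)) z < e" "z + \<i> * of_real (e / 2) \<in> ?T"
        using \<open>Im z = 0\<close> by (auto simp: dist_norm norm_mult)
      then show "\<exists>y\<in>?T. dist y z < e" by blast
    qed
  qed (rule subsetD[OF closure_subset])
  then have "- ?S \<subseteq> closure ?T"
    by (rule subsetI)
  ultimately have "connected (- ?S)"
    by (rule connected_intermediate_closure)
  then have "Borsukian ?S"
    using Borsukian_separation_compact S by blast
  moreover have "continuous_on ?S (c \<circ> Re)"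
    by (intro continuous_on_compose continuous_intros) (use c in \<open>simp add: image_image\<close>)
  moreover have "c \<circ> Re \<in> ?S \<rightarrow> - {0}"
    using c by auto
  ultimately obtain g where g: "continuous_on ?S g" "\<forall>z\<in>?S. (c \<circ> Re) z = exp (g z)"
    unfolding Borsukian_continuous_logarithm by blast
  show ?thesis
  proof (rule that[of "g \<circ> complex_of_real"])
    show "continuous_on C (g \<circ> complex_of_real)"
      using g by (intro continuous_on_compose continuous_intros)
  qed (use g in auto)
qed

lemma has_logarithms_arc:
  assumes rr: "homeomorphic_maps (top_of_set {0..1::real}) (subtopology X J) r r'"
    and J: "J \<subseteq> topspace X"
  shows "has_logarithms X J"
  unfolding has_logarithms_def
proof (intro allI impI)
  fix C c assume C: "closedin X C \<and> C \<subseteq> J \<and> nonvanishing_on X C c"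
  have r: "continuous_map (top_of_set {0..1}) X r" "\<And>t. t \<in> {0..1} \<Longrightarrow> r t \<in> J"
    and r': "continuous_map (subtopology X J) (top_of_set {0..1}) r'"
    and inv: "\<And>t. t \<in> {0..1} \<Longrightarrow> r' (r t) = t" "\<And>x. x \<in> J \<Longrightarrow> r (r' x) = x"
    using rr J unfolding homeomorphic_maps_def
    by (auto simp: continuous_map_in_subtopology Pi_iff)
  define D where "D = {t \<in> {0..1}. r t \<in> C}"
  have "closedin (top_of_set {0..1}) D"
    using closedin_continuous_map_preimage[OF r(1), of C] C by (simp add: D_def)
  then have "compact D"
    using closedin_compact compact_Icc by blast
  have cont_r: "continuous_map (top_of_set D) (subtopology X C) r"
  proof -
    have "D \<subseteq> {0..1}" "r ` D \<subseteq> C"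
      by (auto simp: D_def)
    then show ?thesis
      using continuous_map_from_subtopology_mono[OF r(1), of D]
      by (simp add: continuous_map_in_subtopology image_subset_iff_funcset)
  qed
  have "continuous_map (top_of_set D) euclidean (c \<circ> r)"
    using C by (intro continuous_map_compose[OF cont_r]) (simp add: nonvanishing_on_def)
  then obtain \<psi> where \<psi>: "continuous_on D \<psi>" "\<And>t. t \<in> D \<Longrightarrow> exp (\<psi> t) = (c \<circ> r) t"
    using continuous_logarithm_real[OF \<open>compact D\<close>, of "c \<circ> r"] C
    by (auto simp: nonvanishing_on_def D_def)
  have r'D: "r' x \<in> D" if "x \<in> C" for x
  proof -
    have "x \<in> J" "x \<in> topspace X"
      using that C J by blast+
    then have "r' x \<in> {0..1}"
      using r' by (auto simp: continuous_map_def Pi_iff)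
    then show ?thesis
      using that inv(2)[OF \<open>x \<in> J\<close>] by (simp add: D_def)
  qed
  have "continuous_map (subtopology X C) (top_of_set D) r'"
    using continuous_map_from_subtopology_mono[OF r', of C] C r'D
    by (auto simp: continuous_map_in_subtopology)
  then have "continuous_map (subtopology X C) euclidean (\<psi> \<circ> r')"
    using \<psi>(1) by (intro continuous_map_compose) auto
  moreover have "\<forall>x\<in>C. exp ((\<psi> \<circ> r') x) = c x"
    using \<psi>(2) r'D C inv by auto
  ultimately show "\<exists>\<phi>. continuous_map (subtopology X C) euclidean \<phi> \<and> (\<forall>x\<in>C. exp (\<phi> x) = c x)"
    by blast
qed

text \<open>As \<open>F\<close> and \<open>L\<close> overlap in at most one point, a constant on
  \<open>L\<close> continues \<open>f\<close> over \<open>L\<close>.\<close>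

lemma membrane_not_subset_Un:
  assumes mem: "membrane X F f M" and L: "closedin X L" and q: "F \<inter> L \<subseteq> {q}"
  shows "\<not> M \<subseteq> F \<union> L"
proof
  assume M: "M \<subseteq> F \<union> L"
  have F: "closedin X F" "nonvanishing_on X F f"
    using mem by (auto simp: membrane_def)
  \<comment> \<open>The constant has to match \<open>f\<close> at \<open>q\<close>; when
    \<open>q\<close> is outside \<open>F\<close>, the two sets are disjoint and any nonzero value
    will do.\<close>
  let ?a = "if q \<in> F then f q else 1"
  have "nonvanishing_on X L (\<lambda>x. ?a)"
    using F by (auto simp: nonvanishing_on_def)
  moreover have "f x = ?a" if "x \<in> F" "x \<in> L" for x
    using that q by auto
  ultimately obtain g where "nonvanishing_on X (F \<union> L) g" "\<And>x. x \<in> F \<Longrightarrow> g x = f x"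
    using nonvanishing_pasting[OF F(1) L F(2), of "\<lambda>x. ?a"] by blast
  then have "nonvanishing_extension X F f M"
    using nonvanishing_on_subset M unfolding nonvanishing_extension_def by blast
  then show False
    using mem by (simp add: membrane_def)
qed

text \<open>If both pieces were proper, the boundary values would extend over each of them; a logarithm of
  the quotient of the two extensions on the common part, itself extended by Tietze's theorem, would
  correct one extension so that they fit together.\<close>

lemma membrane_not_separated:
  assumes X: "normal_space X" and mem: "membrane X F f M"
    and L: "closedin X L" "has_logarithms X L" "F \<inter> L \<subseteq> {q}"
    and cl: "closedin X S" "closedin X T" and cov: "M \<subseteq> S \<union> T" and int: "M \<inter> S \<inter> T \<subseteq> F \<union> L"
  shows "M \<subseteq> F \<union> S \<or> M \<subseteq> F \<union> T"
proof (rule ccontr)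
  assume *: "\<not> (M \<subseteq> F \<union> S \<or> M \<subseteq> F \<union> T)"
  have M: "closedin X M" "closedin X F" "F \<subseteq> M" "nonvanishing_on X F f"
    and no_ext: "\<not> nonvanishing_extension X F f M"
    and min: "\<And>N. closedin X N \<Longrightarrow> F \<subseteq> N \<Longrightarrow> N \<subset> M \<Longrightarrow> nonvanishing_extension X F f N"
    using mem by (auto simp: membrane_def)
  define S' where "S' = F \<union> (M \<inter> S)"
  define T' where "T' = F \<union> (M \<inter> T)"
  \<comment> \<open>The two pieces overlap in \<open>F\<close> and \<open>C\<close>. As a closed
    part of \<open>L\<close>, \<open>C\<close> admits logarithms.\<close>
  define C where "C = M \<inter> S \<inter> T \<inter> L"
  have cl': "closedin X S'" "closedin X T'" "closedin X C"
    unfolding S'_def T'_def C_def using M cl L by (auto intro!: closedin_Int closedin_Un)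
  have meet: "S' \<inter> T' = F \<union> C" and join: "S' \<union> T' = M"
    using int cov M(3) unfolding S'_def T'_def C_def by blast+
  have "S' \<subset> M" "T' \<subset> M"
    using * M(3) cov unfolding S'_def T'_def by blast+
  moreover have "F \<subseteq> S'" "F \<subseteq> T'"
    unfolding S'_def T'_def by blast+
  ultimately have "nonvanishing_extension X F f S'" "nonvanishing_extension X F f T'"
    using min cl' by blast+
  then obtain g h where g: "nonvanishing_on X S' g" "\<And>x. x \<in> F \<Longrightarrow> g x = f x"
    and h: "nonvanishing_on X T' h" "\<And>x. x \<in> F \<Longrightarrow> h x = f x"
    unfolding nonvanishing_extension_def by blast
  define c where "c = (\<lambda>x. g x / h x)"
  have "nonvanishing_on X (F \<union> C) c"
    unfolding c_def using meet g h
    by (intro nonvanishing_on_divide nonvanishing_on_subset[OF g(1)] nonvanishing_on_subset[OF h(1)])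
      auto
  then have "nonvanishing_on X C c"
    by (rule nonvanishing_on_subset) blast
  then obtain \<phi>0 where \<phi>0: "continuous_map (subtopology X C) euclidean \<phi>0" "\<And>x. x \<in> C \<Longrightarrow> exp (\<phi>0 x) = c x"
    using L(2) cl'(3) unfolding has_logarithms_def C_def by (metis inf_le2)
  have c1: "c x = 1" if "x \<in> F" for x
    using g(2) h(2) that M(4) by (auto simp: c_def nonvanishing_on_def)
  \<comment> \<open>If \<open>q\<close> lies in \<open>F\<close> and \<open>C\<close>, then
    \<open>c\<close> is 1 there, but its logarithm may be a nonzero multiple of 2 pi i. Subtracting
    that value makes the logarithm vanish at the only possible common point, so it continues by 0
    over \<open>F\<close>.\<close>
  define k where "k = (if q \<in> F \<inter> C then \<phi>0 q else 0)"
  have expk: "exp k = 1"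
    using \<phi>0(2)[of q] c1[of q] by (auto simp: k_def)
  have "continuous_map (subtopology X C) euclidean (\<lambda>x. \<phi>0 x - k)"
    using \<phi>0(1) by (simp add: continuous_map_atin tendsto_diff)
  moreover have "\<phi>0 x - k = 0" if "x \<in> C" "x \<in> F" for x
  proof -
    have "x = q" using that L(3) by (auto simp: C_def)
    then show ?thesis using that by (simp add: k_def)
  qed
  ultimately obtain \<phi> where \<phi>: "continuous_map (subtopology X (C \<union> F)) euclidean \<phi>"
    "\<And>x. x \<in> C \<Longrightarrow> \<phi> x = \<phi>0 x - k" "\<And>x. x \<in> F \<Longrightarrow> \<phi> x = 0"
    using closedin_pasting[OF cl'(3) M(2), of euclidean "\<lambda>x. \<phi>0 x - k" "\<lambda>x. 0"] by auto
  have exp\<phi>: "exp (\<phi> x) = c x" if "x \<in> C \<union> F" for x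
    using that \<phi>(2,3) \<phi>0(2) expk c1 by (cases "x \<in> F") (auto simp: exp_diff)
  obtain \<Phi> where \<Phi>: "continuous_map X euclidean \<Phi>" "\<And>x. x \<in> C \<union> F \<Longrightarrow> \<Phi> x = \<phi> x"
    using Tietze_extension_complex[OF X closedin_Un[OF cl'(3) M(2)] \<phi>(1)] by blast
  have "continuous_map X euclidean (\<lambda>x. - \<Phi> x)"
    using \<Phi>(1) by (simp add: continuous_map_atin tendsto_minus)
  then have g': "nonvanishing_on X S' (\<lambda>x. g x * exp (- \<Phi> x))"
    by (intro nonvanishing_on_mult g(1) nonvanishing_on_exp continuous_map_from_subtopology)
  have agree: "g x * exp (- \<Phi> x) = h x" if "x \<in> S'" "x \<in> T'" for x
  proof -
    have x: "x \<in> C \<union> F"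
      using that meet by blast
    have "g x \<noteq> 0" "h x \<noteq> 0"
      using that g(1) h(1) by (auto simp: nonvanishing_on_def)
    moreover have "exp (\<Phi> x) = g x / h x"
      using exp\<phi>[OF x] \<Phi>(2)[OF x] by (simp add: c_def)
    ultimately show ?thesis
      by (simp add: exp_minus)
  qed
  obtain G where G: "nonvanishing_on X (S' \<union> T') G" "\<And>x. x \<in> T' \<Longrightarrow> G x = h x"
    using nonvanishing_pasting[OF cl'(1,2) g' h(1) agree] by blast
  have "F \<subseteq> T'"
    by (simp add: T'_def)
  then have "nonvanishing_extension X F f M"
    using G h(2) unfolding join nonvanishing_extension_def by (metis subsetD)
  then show False
    using no_ext by blast
qed

text \<open>Together with \<open>membrane_at\<close> this shows that an arc has empty interior. The
  boundary values extend over the part of \<open>M\<close> outside \<open>U - F\<close>. A logarithm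
  of the extension on the part in \<open>J\<close> continues to all of \<open>J\<close> by Tietze's
  theorem, and its exponential supplies the values on the rest of \<open>M\<close>.\<close>

lemma membrane_interior_not_in_logarithm_set:
  assumes X: "normal_space X" and mem: "membrane X F f M" and p: "p \<in> M" "p \<notin> F"
    and J: "closedin X J" "has_logarithms X J" and U: "openin X U" "p \<in> U"
  shows "\<not> U \<subseteq> J"
proof
  assume UJ: "U \<subseteq> J"
  have M: "closedin X M" "closedin X F" "F \<subseteq> M"
    and no_ext: "\<not> nonvanishing_extension X F f M"
    and min: "\<And>N. closedin X N \<Longrightarrow> F \<subseteq> N \<Longrightarrow> N \<subset> M \<Longrightarrow> nonvanishing_extension X F f N"
    using mem by (auto simp: membrane_def)
  define N where "N = M - (U - F)"
  have clN: "closedin X N"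
    unfolding N_def using M U by (intro closedin_diff openin_diff)
  have "F \<subseteq> N" "N \<subset> M"
    using M p U by (auto simp: N_def)
  then obtain g where g: "nonvanishing_on X N g" "\<And>x. x \<in> F \<Longrightarrow> g x = f x"
    using min[OF clN] unfolding nonvanishing_extension_def by blast
  have clNJ: "closedin X (N \<inter> J)"
    using clN J by blast
  obtain \<phi> where \<phi>: "continuous_map (subtopology X (N \<inter> J)) euclidean \<phi>"
      "\<And>x. x \<in> N \<inter> J \<Longrightarrow> exp (\<phi> x) = g x"
    using J(2) clNJ nonvanishing_on_subset[OF g(1), of "N \<inter> J"] unfolding has_logarithms_def
    by (metis inf_le1 inf_le2)
  obtain \<Phi> where \<Phi>: "continuous_map X euclidean \<Phi>" "\<And>x. x \<in> N \<inter> J \<Longrightarrow> \<Phi> x = \<phi> x"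
    using Tietze_extension_complex[OF X clNJ \<phi>(1)] by blast
  have "nonvanishing_on X J (\<lambda>x. exp (\<Phi> x))"
    by (intro nonvanishing_on_exp continuous_map_from_subtopology \<Phi>(1))
  moreover have "g x = exp (\<Phi> x)" if "x \<in> N" "x \<in> J" for x
    using that \<phi>(2) \<Phi>(2) by simp
  ultimately obtain G where G: "nonvanishing_on X (N \<union> J) G" "\<And>x. x \<in> N \<Longrightarrow> G x = g x"
    using nonvanishing_pasting[OF clN J(1) g(1)] by blast
  have "M \<subseteq> N \<union> J"
    using UJ by (auto simp: N_def)
  then have "nonvanishing_on X M G"
    using G(1) by (rule nonvanishing_on_subset[rotated])
  then have "nonvanishing_extension X F f M"
    using G(2) g(2) \<open>F \<subseteq> N\<close> unfolding nonvanishing_extension_def by (metis subsetD)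
  then show False
    using no_ext by blast
qed

section \<open>Arcs do not separate\<close>

lemma arc_not_separating:
  assumes X: "metrizable_space X" "separable_space X" "locally_compact_space X"
    and slh: "strongly_locally_homogeneous X" and conn: "connected_space X"
    and dim: "\<not> covering_dim_le X 1"
    and rr: "homeomorphic_maps (top_of_set {0..1::real}) (subtopology X J) r r'"
    and J: "J \<subseteq> topspace X"
    and op: "openin X A" "openin X B" and ne: "A \<noteq> {}" "B \<noteq> {}" and disj: "A \<inter> B = {}"
    and un: "A \<union> B = topspace X - J"
  shows False
proof -
  have norm: "normal_space X" and haus: "Hausdorff_space X"
    using X(1) metrizable_imp_normal_space metrizable_imp_Hausdorff_space by blast+
  have r: "continuous_map (top_of_set {0..1}) X r" and rJ: "r ` {0..1} = J"
    and inj: "\<And>t u. t \<in> {0..1} \<Longrightarrow> u \<in> {0..1} \<Longrightarrow> r t = r u \<Longrightarrow> t = u"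
  proof -
    show "continuous_map (top_of_set {0..1}) X r"
      using rr by (simp add: homeomorphic_maps_def continuous_map_in_subtopology)
    have "homeomorphic_map (top_of_set {0..1}) (subtopology X J) r"
      using rr by (auto simp: homeomorphic_map_maps)
    then show "r ` {0..1} = J"
      using homeomorphic_imp_surjective_map[of "top_of_set {0..1}" "subtopology X J" r] J
      by (simp add: Int_absorb1)
    show "t = u" if "t \<in> {0..1}" "u \<in> {0..1}" "r t = r u" for t u
      using rr that unfolding homeomorphic_maps_def by (metis topspace_euclidean_subtopology)
  qed
  have pre: "compact {t \<in> {0..1}. r t \<in> T}" if "closedin X T" for T
    using closedin_continuous_map_preimage[OF r that] closedin_compact compact_Icc by force
  have im: "closedin X (r ` K)" if "compact K" "K \<subseteq> {0..1}" for K
    using that image_compactin[OF _ r, of K] compactin_imp_closedin[OF haus]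
    by (simp add: compactin_subtopology)
  have clJ: "closedin X J"
    using im[of "{0..1}"] rJ by simp
  have logJ: "has_logarithms X J"
    using has_logarithms_arc[OF rr J] .

  \<comment> \<open>The two closures and their first common point on the arc\<close>
  define P where "P = X closure_of A \<inter> X closure_of B"
  \<comment> \<open>A point outside both closures would be interior to \<open>J\<close>; a membrane
    containing it off the boundary excludes this.\<close>
  have cover: "X closure_of A \<union> X closure_of B = topspace X"
  proof (rule ccontr)
    assume "\<not> ?thesis"
    then obtain x where x: "x \<in> topspace X" "x \<notin> X closure_of A \<union> X closure_of B"
      using closure_of_subset_topspace[of X A] closure_of_subset_topspace[of X B] by auto
    let ?U = "topspace X - (X closure_of A \<union> X closure_of B)"
    have "openin X ?U" "x \<in> ?U"
      using x by (auto intro!: openin_diff closedin_Un)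
    moreover have "?U \<subseteq> J"
      using un closure_of_subset[OF openin_subset[OF op(1)]] closure_of_subset[OF openin_subset[OF op(2)]]
      by blast
    moreover obtain F f M where "membrane X F f M" "x \<in> M" "x \<notin> F"
      using membrane_at[OF X slh conn dim x(1)] by blast
    ultimately show False
      using membrane_interior_not_in_logarithm_set[OF norm _ _ _ clJ logJ] by blast
  qed
  have sub: "A \<subseteq> X closure_of A" "B \<subseteq> X closure_of B"
    using op by (simp_all add: closure_of_subset openin_subset)
  have "P \<noteq> {}"
  proof
    assume "P = {}"
    moreover have "closedin X (X closure_of A)" "closedin X (X closure_of B)"
      by simp_all
    ultimately show False
      using conn ne sub cover unfolding connected_space_closedin_eq P_def by blast
  qed
  have disjcl: "X closure_of A \<inter> B = {}" "A \<inter> X closure_of B = {}"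
    using disj openin_Int_closure_of_eq_empty[OF op(1), of B] openin_Int_closure_of_eq_empty[OF op(2), of A]
    by blast+
  then have "P \<subseteq> J"
    using un closure_of_subset_topspace[of X A] by (auto simp: P_def)
  define R where "R = {t \<in> {0..1}. r t \<in> P}"
  have "compact R"
    unfolding R_def P_def by (intro pre closedin_Int closedin_closure_of)
  moreover have "R \<noteq> {}"
    using \<open>P \<noteq> {}\<close> \<open>P \<subseteq> J\<close> rJ by (auto simp: R_def)
  ultimately have "\<exists>s\<in>R. \<forall>t\<in>R. s \<le> t"
    by (rule compact_attains_inf)
  then obtain s where s: "s \<in> R" "\<And>t. t \<in> R \<Longrightarrow> s \<le> t"
    by blast
  then have s01: "s \<in> {0..1}" and "r s \<in> P"
    by (auto simp: R_def)
  define p where "p = r s"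
  have p: "p \<in> P" "p \<in> topspace X"
    using \<open>r s \<in> P\<close> closure_of_subset_topspace[of X A] by (auto simp: p_def P_def)
  define J' where "J' = r ` {s..1}"
  have clJ': "closedin X J'"
    unfolding J'_def by (rule im) (use s01 in auto)
  have "J' \<subseteq> J"
    unfolding J'_def using rJ s01 by auto
  have PJ': "P \<subseteq> J'"
  proof
    fix x assume "x \<in> P"
    then obtain t where t: "t \<in> {0..1}" "x = r t"
      using \<open>P \<subseteq> J\<close> rJ by blast
    then show "x \<in> J'"
      using s(2)[of t] \<open>x \<in> P\<close> by (auto simp: R_def J'_def)
  qed

  \<comment> \<open>A membrane at \<open>p\<close> with enlarged boundary\<close>
  obtain F f M where mem: "membrane X F f M" and pM: "p \<in> M" "p \<notin> F"
    using membrane_at[OF X slh conn dim p(2)] by blast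
  have M: "closedin X M" "compactin X M" "closedin X F" "F \<subseteq> M"
    using mem by (auto simp: membrane_def)
  \<comment> \<open>\<open>p\<close> is off the closed set \<open>F\<close>, so a short piece of the
    arc after \<open>p\<close> is too. The value \<open>d\<close> may exceed 1, for instance when
    \<open>s\<close> is 1; then \<open>L\<close> is all of \<open>J'\<close> and \<open>T\<close> is
    empty.\<close>
  obtain d where d: "s < d" "\<And>t. t \<in> {0..1} \<Longrightarrow> t \<in> {s..d} \<Longrightarrow> r t \<notin> F"
  proof -
    have "open (- {t \<in> {0..1}. r t \<in> F})"
      by (intro open_Compl compact_imp_closed pre M(3))
    moreover have "s \<in> - {t \<in> {0..1}. r t \<in> F}"
      using pM(2) by (simp add: p_def)
    ultimately obtain e where e: "0 < e" "ball s e \<subseteq> - {t \<in> {0..1}. r t \<in> F}"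
      by (rule openE)
    show ?thesis
    proof (rule that[of "s + e / 2"])
      show "s < s + e / 2"
        using e(1) by simp
      fix t assume t: "t \<in> {0..1}" "t \<in> {s..s + e / 2}"
      then have "t \<in> ball s e"
        using e(1) by (auto simp: dist_real_def)
      then show "r t \<notin> F"
        using e(2) t(1) by blast
    qed
  qed
  define L where "L = r ` ({s..1} \<inter> {..d})"
  define T where "T = r ` ({s..1} \<inter> {d..})"
  have cl: "closedin X L" "closedin X T"
    unfolding L_def T_def using s01 by (auto intro!: im compact_Int_closed)
  have J'LT: "J' \<subseteq> L \<union> T"
    by (force simp: J'_def L_def T_def)
  have LF: "L \<inter> F = {}"
    using d(2) s01 by (auto simp: L_def)
  have LT: "L \<inter> T \<subseteq> {r d}"
  proof
    fix x assume "x \<in> L \<inter> T"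
    then obtain t u where "t \<in> {s..1}" "t \<le> d" "x = r t" "u \<in> {s..1}" "d \<le> u" "x = r u"
      by (auto simp: L_def T_def)
    moreover from this have "t = u"
      using s01 by (intro inj) auto
    ultimately show "x \<in> {r d}" by simp
  qed
  have pT: "p \<notin> T"
  proof
    assume "p \<in> T"
    then obtain t where "t \<in> {s..1}" "d \<le> t" "r s = r t"
      by (auto simp: T_def p_def)
    then show False
      using inj[of s t] s01 d(1) by auto
  qed
  have "L \<subseteq> J'"
    by (auto simp: L_def J'_def)
  have logL: "has_logarithms X L"
    using has_logarithms_subset[OF logJ] \<open>L \<subseteq> J'\<close> \<open>J' \<subseteq> J\<close> by blast
  obtain W where W: "homogeneous_open X W" "p \<in> W" "W \<subseteq> topspace X - (F \<union> T)"
  proof -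
    have "openin X (topspace X - (F \<union> T))" "p \<in> topspace X - (F \<union> T)"
      using M cl pM pT p by auto
    then show ?thesis
      using strongly_locally_homogeneousE[OF slh] that by metis
  qed
  have opW: "openin X W"
    using W(1) by (simp add: homogeneous_open_def)
  have clMW: "closedin X (M - W)"
    by (rule closedin_diff[OF M(1) opW])
  have "F \<subseteq> M - W" "M - W \<subset> M"
    using M W pM by blast+
  then have "nonvanishing_extension X F f (M - W)"
    using mem clMW by (simp add: membrane_def)
  then obtain g where g: "nonvanishing_on X (M - W) g" "\<And>x. x \<in> F \<Longrightarrow> g x = f x"
    unfolding nonvanishing_extension_def by blast
  \<comment> \<open>With \<open>M \<inter> T\<close> absorbed into the boundary, \<open>L\<close> is
    the only piece of \<open>J'\<close> left to be handled by logarithms, and it meets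
    \<open>F'\<close> at most in \<open>r d\<close>. The new boundary values come from the extension
    \<open>g\<close> over \<open>M - W\<close>.\<close>
  define F' where "F' = F \<union> (M \<inter> T)"
  have F': "closedin X F'" "F' \<subseteq> M" "F' \<subseteq> M - W" "F' \<inter> W = {}"
    using M cl W by (auto simp: F'_def)
  have gF': "nonvanishing_on X F' g"
    using nonvanishing_on_subset[OF g(1) F'(3)] .
  have "\<not> nonvanishing_extension X F' g M"
  proof
    assume "nonvanishing_extension X F' g M"
    then have "nonvanishing_extension X F f M"
      using g(2) by (auto simp: nonvanishing_extension_def F'_def)
    then show False
      using mem by (simp add: membrane_def)
  qed
  then obtain M1 where M1: "M1 \<subseteq> M" "membrane X F' g M1"
    using membrane_exists[OF norm M(2,1) F'(1,2) gF'] by blast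
  \<comment> \<open>The smaller membrane \<open>M1\<close> may have lost \<open>p\<close>. It still
    meets \<open>W\<close>, because \<open>g\<close> is already an extension off \<open>W\<close>; a
    homeomorphism supported in \<open>W\<close> then brings one of its points to \<open>p\<close>
    and fixes \<open>F'\<close>.\<close>
  have "M1 \<inter> W \<noteq> {}"
  proof
    assume "M1 \<inter> W = {}"
    then have "nonvanishing_on X M1 g"
      using M1(1) by (intro nonvanishing_on_subset[OF g(1)]) blast
    then have "nonvanishing_extension X F' g M1"
      unfolding nonvanishing_extension_def by blast
    then show False
      using M1(2) by (simp add: membrane_def)
  qed
  then obtain k where k: "k \<in> M1" "k \<in> W" by blast
  obtain h where h: "homeomorphic_map X X h" "h k = p"
      "\<And>x. x \<in> topspace X \<Longrightarrow> x \<notin> W \<Longrightarrow> h x = x"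
    using homogeneous_openE[OF W(1) k(2) W(2)] by blast
  define N where "N = h ` M1"
  have F't: "F' \<subseteq> topspace X"
    by (rule closedin_subset[OF F'(1)])
  have memN: "membrane X F' g N"
    unfolding N_def
    by (rule membrane_homeomorphic_fixing[OF h(1) _ M1(2)]) (use h(3) F' F't in blast)
  have pN: "p \<in> N"
    using k h by (auto simp: N_def)
  have q: "F' \<inter> L \<subseteq> {r d}"
    using LF LT by (auto simp: F'_def)
  \<comment> \<open>A point of \<open>T\<close> in the moved set lies off the support
    \<open>V\<close>, so it is fixed and by injectivity comes from itself. Moving a membrane thus
    creates no new contact with \<open>T\<close>.\<close>
  have moved: "k ` S \<inter> T \<subseteq> F'"
    if "S \<subseteq> topspace X" "S \<inter> T \<subseteq> F'" "homeomorphic_map X X k"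
      and fix_k: "\<And>x. x \<in> topspace X \<Longrightarrow> x \<notin> V \<Longrightarrow> k x = x" and V: "V \<inter> T = {}" "V \<subseteq> topspace X"
    for k S V
  proof
    fix y assume "y \<in> k ` S \<inter> T"
    then obtain x where x: "x \<in> S" "y = k x" "y \<in> T" by blast
    have "x \<in> topspace X" "y \<in> topspace X" "y \<notin> V"
      using x that(1) V closedin_subset[OF cl(2)] by blast+
    then have "k y = k x"
      using fix_k[of y] x by simp
    moreover have "inj_on k (topspace X)"
      using that(3) by (simp add: homeomorphic_eq_everything_map)
    ultimately have "y = x"
      using \<open>x \<in> topspace X\<close> \<open>y \<in> topspace X\<close> by (simp add: inj_on_eq_iff)
    then show "y \<in> F'"
      using x that(2) by blast
  qed
  have "M1 \<subseteq> topspace X" "N \<subseteq> topspace X"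
    using M1(2) memN by (simp_all add: membrane_def closedin_subset)
  have "M1 \<inter> T \<subseteq> F'"
    using M1(1) by (auto simp: F'_def)
  moreover have "W \<inter> T = {}" "W \<subseteq> topspace X"
    using W(3) by blast+
  ultimately have NT: "N \<inter> T \<subseteq> F'"
    unfolding N_def using moved[OF \<open>M1 \<subseteq> topspace X\<close> _ h(1,3)] by simp

  \<comment> \<open>The last motion and the contradiction\<close>
  obtain x where x: "x \<in> N" "x \<notin> F' \<union> L"
    using membrane_not_subset_Un[OF memN cl(1) q] by blast
  then have xJ': "x \<notin> J'"
    using NT J'LT by blast
  have "x \<in> topspace X"
    using x \<open>N \<subseteq> topspace X\<close> by blast
  \<comment> \<open>\<open>x\<close> is kept out of the support, so the last motion leaves it in the
    membrane.\<close>
  obtain V where V: "homogeneous_open X V" "p \<in> V" "V \<subseteq> topspace X - (F' \<union> T \<union> {x})"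
  proof -
    have px: "p \<noteq> x"
      using xJ' s01 by (auto simp: p_def J'_def)
    have "closedin X {x}"
      using \<open>x \<in> topspace X\<close> by (simp add: closedin_Hausdorff_sing_eq[OF haus])
    then have "openin X (topspace X - (F' \<union> T \<union> {x}))"
      using F'(1) cl(2) by (intro openin_diff openin_topspace closedin_Un)
    moreover have "p \<in> topspace X - (F' \<union> T \<union> {x})"
      using F'(4) p(2) pT W(2) px by blast
    ultimately show ?thesis
      using strongly_locally_homogeneousE[OF slh] that by metis
  qed
  have opV: "openin X V"
    using V(1) by (simp add: homogeneous_open_def)
  \<comment> \<open>\<open>S\<close> is the side whose closure contains \<open>x\<close>, and
    \<open>S'\<close> is the side into which \<open>p\<close> is moved.\<close>
  have contra: False
    if xS: "x \<in> X closure_of S" and S: "S = A \<and> S' = B \<or> S = B \<and> S' = A" for S S'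
  proof -
    have P: "P = X closure_of S \<inter> X closure_of S'"
      using S by (auto simp: P_def)
    have "p \<in> X closure_of S'"
      using p P by blast
    then obtain b where b: "b \<in> S'" "b \<in> V"
      using opV V(2) unfolding in_closure_of by metis
    have "X closure_of S \<inter> S' = {}" "S' \<inter> J = {}"
      using S disjcl un by (auto simp: Int_commute)
    then have b_off: "b \<notin> X closure_of S" "b \<notin> J'" "b \<notin> F'"
      using b \<open>J' \<subseteq> J\<close> V(3) by blast+
    have x_off: "x \<notin> X closure_of S'"
      using xS P PJ' xJ' by blast
    obtain l where l: "homeomorphic_map X X l" "l p = b"
        "\<And>y. y \<in> topspace X \<Longrightarrow> y \<notin> V \<Longrightarrow> l y = y"
      using homogeneous_openE[OF V(1,2) b(2)] by blast
    have memlN: "membrane X F' g (l ` N)"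
      by (rule membrane_homeomorphic_fixing[OF l(1) _ memN]) (use l(3) F't V(3) in blast)
    have lNT: "l ` N \<inter> T \<subseteq> F'"
    proof (rule moved[OF \<open>N \<subseteq> topspace X\<close> NT l(1,3)])
      show "V \<inter> T = {}" "V \<subseteq> topspace X"
        using V(3) by blast+
    qed
    have "l ` N \<subseteq> topspace X"
      using memlN by (simp add: membrane_def closedin_subset)
    have clS: "closedin X (X closure_of S \<union> J')" "closedin X (X closure_of S' \<union> J')"
      using clJ' by auto
    \<comment> \<open>The two closed sets overlap exactly in \<open>J'\<close>, since
      \<open>P \<subseteq> J'\<close>. Within the membrane, the part of the overlap in
      \<open>T\<close> is on the boundary by \<open>lNT\<close>, and the rest is in
      \<open>L\<close>. The first alternative is refuted by \<open>b\<close>, the second by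
      \<open>x\<close>.\<close>
    have "l ` N \<subseteq> F' \<union> (X closure_of S \<union> J') \<or> l ` N \<subseteq> F' \<union> (X closure_of S' \<union> J')"
    proof (rule membrane_not_separated[OF norm memlN cl(1) logL q clS])
      show "l ` N \<subseteq> (X closure_of S \<union> J') \<union> (X closure_of S' \<union> J')"
        using cover S \<open>l ` N \<subseteq> topspace X\<close> by blast
      show "l ` N \<inter> (X closure_of S \<union> J') \<inter> (X closure_of S' \<union> J') \<subseteq> F' \<union> L"
        using P PJ' J'LT lNT by blast
    qed
    moreover have "b \<in> l ` N"
      using l(2) pN by blast
    moreover have "l x = x"
      using l(3)[OF \<open>x \<in> topspace X\<close>] V(3) by blast
    then have "x \<in> l ` N"
      using x(1) by (metis imageI)
    ultimately show False
      using b_off x_off x xJ' by blast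
  qed
  show False
    using contra[of A B] contra[of B A] cover \<open>x \<in> topspace X\<close> by blast
qed

theorem theorem1p1:
  fixes X :: "'a topology" and G :: "'a set" and n :: int
  assumes "metrizable_space X"
    and "separable_space X"
    and "locally_compact_space X"
    and "strongly_locally_homogeneous X"
    and "region_in X G"
    and "n \<ge> 2"
    and "has_covering_dim (subtopology X G) n"
  shows "\<forall>J. J \<subseteq> G \<and> arc_in X J \<longrightarrow>
    \<not> separates_in X J G \<and> connectedin X (G - J)"
proof (intro allI impI)
  fix J assume J: "J \<subseteq> G \<and> arc_in X J"
  \<comment> \<open>The hypotheses pass to the open subspace \<open>?G\<close>, which as a region is
    a connected space, and the arc keeps its topology.\<close>
  let ?G = "subtopology X G"
  have G: "openin X G" "connected_space ?G"
    using assms(5) by (auto simp: region_in_def connectedin_def)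
  then have Gt: "topspace ?G = G"
    using openin_subset by (auto simp: topspace_subtopology)
  \<comment> \<open>Since \<open>n - 1\<close> is at least 1, a bound by 1 would give the excluded
    bound by \<open>n - 1\<close>.\<close>
  have "\<not> covering_dim_le ?G 1"
    using assms(6,7) covering_dim_le_mono[of ?G 1 "n - 1"] by (auto simp: has_covering_dim_def)
  moreover have "locally_compact_space ?G"
    using assms(1,3) G(1) locally_compact_space_open_subset metrizable_imp_Hausdorff_space by blast
  moreover have "subtopology ?G J = subtopology X J"
    using J by (simp add: subtopology_subtopology Int_absorb1)
  then obtain r r' where "homeomorphic_maps (top_of_set {0..1::real}) (subtopology ?G J) r r'"
    using J by (metis arc_in_def homeomorphic_space_def homeomorphic_space_sym)
  ultimately have no_sep: False
    if "openin ?G A" "openin ?G B" "A \<noteq> {}" "B \<noteq> {}" "A \<inter> B = {}" "A \<union> B = topspace ?G - J" for A B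
    using arc_not_separating[of ?G J r r' A B] that J assms G Gt metrizable_space_subtopology
      separable_space_open_subset strongly_locally_homogeneous_open_subset by blast
  have "closedin X J"
    using J assms(1) unfolding arc_in_def
    by (metis compact_Icc compact_space_subtopology compactin_euclidean_iff compactin_imp_closedin
        compactin_subspace homeomorphic_compact_space metrizable_imp_Hausdorff_space)
  then have opGJ: "openin X (G - J)"
    using G(1) by blast
  have "\<not> separates_in X J G"
  proof
    assume "separates_in X J G"
    then obtain A B where AB: "openin (subtopology X (G - J)) A" "openin (subtopology X (G - J)) B"
      "A \<noteq> {}" "B \<noteq> {}" "A \<inter> B = {}" "A \<union> B = G - J"
      unfolding separates_in_def by blast
    then have "openin ?G A" "openin ?G B"
      using opGJ G(1) by (auto simp: openin_open_subtopology)
    then show False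
      using no_sep[of A B] AB Gt by simp
  qed
  moreover have "connectedin X (G - J)" if "\<not> separates_in X J G"
    using that opGJ openin_subset[OF opGJ]
    unfolding separates_in_def connectedin_def connected_space_eq by (auto simp: Int_absorb1)
  ultimately show "\<not> separates_in X J G \<and> connectedin X (G - J)"
    by blast
qed

end
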